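(* The map $X\mapsto X\,d\log z$ induces a surjection $$\mathcal{J}(\mathfrak{sl}_n)\to\{\text{regular }\mathrm{SL}_n\text{-connections}\}/\text{relationship}.$$ For $X,Y\in\mathcal{J}(\mathfrak{sl}_n)$, the connections $X\,d\log z$ and $Y\,d\log z$ are related if and only if $X$ and $Y$ differ rationally after block permutation.
   Context: $k$ is an algebraically closed field of characteristic zero and $K=k((z))$. An $\mathrm{SL}_n$-connection is an element of $\mathfrak{sl}_n(K)\,d\log z$, where $d\log z=z^{-1}dz$. The group $\mathrm{SL}_n(K)$ acts by $g[A\,d\log z]=(gAg^{-1}+z\partial_z(g)g^{-1})\,d\log z$ ($z\partial_z$ entrywise); connections in the same orbit are gauge equivalent. A connection is regular if it is gauge equivalent to an element of $\mathfrak{sl}_n[[z]]\,d\log z$. For a positive integer $m$, $m^*(A(z)\,d\log z)=mA(z^m)\,d\log z$. Two connections $A,B$ are related if $m^*(A)$ and $m^*(B)$ are gauge equivalent for some $m\ge1$; this is an equivalence relation ("relationship"). $\mathrm{J}(x,a)$ is the $a\times a$ Jordan block with diagonal entries $x\in k$ and entries $1$ just above the diagonal; $\mathcal{J}_n$ is the set of $n\times n$ matrices over $k$ in Jordan normal form (block diagonal with such blocks), and $\mathcal{J}(\mathfrak{sl}_n)=\mathfrak{sl}_n(k)\cap\mathcal{J}_n$. Two matrices $X=\mathrm{blockdiag}(\mathrm{J}(x_1,a_1),\dots,\mathrm{J}(x_r,a_r))$ and $Y=\mathrm{blockdiag}(\mathrm{J}(y_1,b_1),\dots,\mathrm{J}(y_s,b_s))$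 differ rationally after block permutation if $r=s$ and there is a permutation $\tau$ of $\{1,\dots,r\}$ with $a_i=b_{\tau(i)}$ and $x_i-y_{\tau(i)}\in\mathbb{Q}$ for all $i$. *)

theory Defs
  imports
    "Jordan_Normal_Form.Jordan_Normal_Form"
    "Jordan_Normal_Form.Gauss_Jordan_Elimination"
    "HOL-Computational_Algebra.Formal_Laurent_Series"
    "HOL-Combinatorics.Permutations"
begin

text \<open>
  The connection \<open>A d log z\<close> is represented by its coefficient matrix \<open>A\<close> over the field
  \<open>'k fls\<close> of formal Laurent series in \<open>z = fls_X\<close>.
\<close>

definition mat_trace :: "'a::comm_monoid_add mat \<Rightarrow> 'a" where
  "mat_trace A = (\<Sum>i<dim_row A. A $$ (i, i))"

definition sl :: "nat \<Rightarrow> 'a::comm_ring_1 mat set" where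
  "sl n = {A \<in> carrier_mat n n. mat_trace A = 0}"

definition SL :: "nat \<Rightarrow> 'a::comm_ring_1 mat set" where
  "SL n = {g \<in> carrier_mat n n. det g = 1}"

definition z_deriv :: "'k::field fls \<Rightarrow> 'k fls" where
  "z_deriv f = fls_X * fls_deriv f"

text \<open>On \<open>SL n\<close> the option \<open>mat_inverse g\<close> is never \<open>None\<close>; see \<open>SL_inverse\<close> below.\<close>

definition gauge :: "'k::field fls mat \<Rightarrow> 'k fls mat \<Rightarrow> 'k fls mat" where
  "gauge g A = g * A * the (mat_inverse g) + map_mat z_deriv g * the (mat_inverse g)"

definition gauge_equivalent :: "nat \<Rightarrow> 'k::field fls mat \<Rightarrow> 'k fls mat \<Rightarrow> bool" where
  "gauge_equivalent n A B \<longleftrightarrow> (\<exists>g \<in> SL n. B = gauge g A)"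

definition sl_power_series :: "nat \<Rightarrow> 'k::field fls mat set" where
  "sl_power_series n = {A \<in> sl n. \<forall>i<n. \<forall>j<n. A $$ (i, j) \<in> range fps_to_fls}"

definition regular_connections :: "nat \<Rightarrow> 'k::field fls mat set" where
  "regular_connections n = {A \<in> sl n. \<exists>B \<in> sl_power_series n. gauge_equivalent n A B}"

text \<open>
  The coefficient matrix of \<open>m\<^sup>*(A d log z)\<close>; the scalar \<open>m\<close> comes from
  \<open>d log (z\<^sup>m) = m d log z\<close>.
\<close>

definition pullback :: "nat \<Rightarrow> 'k::field fls mat \<Rightarrow> 'k fls mat" where
  "pullback m A = of_nat m \<cdot>\<^sub>m map_mat (\<lambda>f. fls_compose_power f m) A"

definition related :: "nat \<Rightarrow> 'k::field fls mat \<Rightarrow> 'k fls mat \<Rightarrow> bool" where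
  "related n A B \<longleftrightarrow> (\<exists>m\<ge>1. gauge_equivalent n (pullback m A) (pullback m B))"

definition relationship_on :: "nat \<Rightarrow> 'k::field fls mat set \<Rightarrow> ('k fls mat \<times> 'k fls mat) set" where
  "relationship_on n S = {(A, B) \<in> S \<times> S. related n A B}"

definition dlog :: "'k::field mat \<Rightarrow> 'k fls mat" where
  "dlog X = map_mat fls_const X"

text \<open>
  A list \<open>[(a\<^sub>1, x\<^sub>1), \<dots>]\<close> of sizes and eigenvalues describes \<open>blockdiag(J(x\<^sub>1, a\<^sub>1), \<dots>)\<close>.
  Blocks of size zero are excluded, so that the list is determined by the matrix.
\<close>

definition jordan_blocks_of :: "'k::field mat \<Rightarrow> (nat \<times> 'k) list \<Rightarrow> bool" where
  "jordan_blocks_of X bs \<longleftrightarrow> (\<forall>b \<in> set bs. fst b \<ge> 1) \<and> X = jordan_matrix bs"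

definition jordan_normal_forms :: "nat \<Rightarrow> 'k::field mat set" where
  "jordan_normal_forms n = {X \<in> carrier_mat n n. \<exists>bs. jordan_blocks_of X bs}"

definition jordan_sl :: "nat \<Rightarrow> 'k::field mat set" where
  "jordan_sl n = sl n \<inter> jordan_normal_forms n"

definition differ_rationally_after_block_permutation :: "'k::field_char_0 mat \<Rightarrow> 'k mat \<Rightarrow> bool" where
  "differ_rationally_after_block_permutation X Y \<longleftrightarrow>
     (\<exists>xs ys. jordan_blocks_of X xs \<and> jordan_blocks_of Y ys \<and> length xs = length ys \<and>
       (\<exists>\<tau>. \<tau> permutes {..<length xs} \<and>
          (\<forall>i<length xs. fst (xs ! i) = fst (ys ! \<tau> i) \<and> snd (xs ! i) - snd (ys ! \<tau> i) \<in> \<rat>)))"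


text \<open>Relationship is an equivalence relation, so the quotient by it makes sense.\<close>

lemma SL_inverse:
  fixes g :: "'a::field mat"
  assumes "g \<in> SL n"
  shows "the (mat_inverse g) \<in> carrier_mat n n"
    and "g * the (mat_inverse g) = 1\<^sub>m n" and "the (mat_inverse g) * g = 1\<^sub>m n"
proof -
  have g: "g \<in> carrier_mat n n" and d: "det g = 1" using assms by (auto simp: SL_def)
  have "g \<in> Units (ring_mat TYPE('a) n ())"
    using det_non_zero_imp_unit[OF g] d by simp
  then obtain h where h: "mat_inverse g = Some h"
    using mat_inverse(1)[OF g, of "()"] by (cases "mat_inverse g") auto
  from mat_inverse(2)[OF g h] h
  show "the (mat_inverse g) \<in> carrier_mat n n"
    and "g * the (mat_inverse g) = 1\<^sub>m n" and "the (mat_inverse g) * g = 1\<^sub>m n" by auto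
qed

lemma mat_inverse_unique:
  fixes g h :: "'a::field mat"
  assumes "g \<in> SL n" "h \<in> carrier_mat n n" "h * g = 1\<^sub>m n"
  shows "the (mat_inverse g) = h"
proof -
  note I = SL_inverse[OF assms(1)]
  have g: "g \<in> carrier_mat n n" using assms by (simp add: SL_def)
  have "the (mat_inverse g) = (h * g) * the (mat_inverse g)" using assms(3) I by simp
  also have "\<dots> = h * (g * the (mat_inverse g))" by (rule assoc_mult_mat[OF assms(2) g I(1)])
  finally show ?thesis using I(2) assms(2) by simp
qed

lemma SL_one: "1\<^sub>m n \<in> SL n"
  by (simp add: SL_def)

lemma SL_mult: "g \<in> SL n \<Longrightarrow> h \<in> SL n \<Longrightarrow> g * h \<in> SL n"
  by (auto simp: SL_def det_mult)

lemma SL_mat_inverse: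
  fixes g :: "'a::field mat"
  assumes "g \<in> SL n" shows "the (mat_inverse g) \<in> SL n"
proof -
  note I = SL_inverse[OF assms]
  have g: "g \<in> carrier_mat n n" "det g = 1" using assms by (auto simp: SL_def)
  have "det g * det (the (mat_inverse g)) = 1"
    using det_mult[OF g(1) I(1)] I(2) by simp
  with g I(1) show ?thesis by (simp add: SL_def)
qed

lemma z_deriv_simps:
  "z_deriv 0 = 0" "z_deriv 1 = 0" "z_deriv (f + g) = z_deriv f + z_deriv g"
  "z_deriv (f * g) = z_deriv f * g + f * z_deriv g"
  by (simp_all add: z_deriv_def algebra_simps)

lemma z_deriv_sum: "z_deriv (sum f A) = (\<Sum>x\<in>A. z_deriv (f x))"
  by (induction A rule: infinite_finite_induct) (simp_all add: z_deriv_simps)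

lemma z_deriv_mult_mat:
  assumes "g \<in> carrier_mat n n" "h \<in> carrier_mat n n"
  shows "map_mat z_deriv (g * h) = map_mat z_deriv g * h + g * map_mat z_deriv h"
  using assms
  by (intro eq_matI) (auto simp: scalar_prod_def z_deriv_sum z_deriv_simps sum.distrib)

lemma gauge_one: "A \<in> carrier_mat n n \<Longrightarrow> gauge (1\<^sub>m n) A = A"
proof -
  assume A: "A \<in> carrier_mat n n"
  have i: "the (mat_inverse (1\<^sub>m n :: 'a fls mat)) = 1\<^sub>m n"
    by (rule mat_inverse_unique[OF SL_one]) auto
  have "map_mat z_deriv (1\<^sub>m n :: 'a fls mat) = 0\<^sub>m n n"
    by (intro eq_matI) (auto simp: z_deriv_simps)
  with A show ?thesis by (simp add: gauge_def i)
qed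

lemma gauge_mult:
  assumes A: "A \<in> carrier_mat n n" and g: "g \<in> SL n" and h: "h \<in> SL n"
  shows "gauge g (gauge h A) = gauge (g * h) A"
proof -
  define g' h' where "g' = the (mat_inverse g)" and "h' = the (mat_inverse h)"
  note G = SL_inverse[OF g, folded g'_def] and H = SL_inverse[OF h, folded h'_def]
  have C: "g \<in> carrier_mat n n" "h \<in> carrier_mat n n"
    using g h by (auto simp: SL_def)
  have D: "map_mat z_deriv g \<in> carrier_mat n n" "map_mat z_deriv h \<in> carrier_mat n n"
    using C by auto
  have "(h' * g') * (g * h) = h' * (g' * (g * h))"
    using G H C by (simp add: assoc_mult_mat[of _ n n _ n _ n])
  also have "g' * (g * h) = h"
    using G H C by (simp add: assoc_mult_mat[of _ n n _ n _ n, symmetric])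
  finally have i: "the (mat_inverse (g * h)) = h' * g'"
    using G(1) H C by (intro mat_inverse_unique[OF SL_mult[OF g h]]) auto
  have c: "map_mat z_deriv g * h * (h' * g') = map_mat z_deriv g * g'"
  proof -
    have "map_mat z_deriv g * h * (h' * g') = map_mat z_deriv g * ((h * h') * g')"
      using G(1) H(1) C D by (simp add: assoc_mult_mat[of _ n n _ n _ n])
    then show ?thesis using G H by simp
  qed
  have "gauge (g * h) A = g * h * A * (h' * g') +
      (map_mat z_deriv g * h + g * map_mat z_deriv h) * (h' * g')"
    by (simp add: gauge_def i z_deriv_mult_mat[OF C])
  also have "\<dots> = g * h * A * (h' * g') +
      (map_mat z_deriv g * g' + g * map_mat z_deriv h * (h' * g'))"
    using A C D G(1) H(1) by (simp add: add_mult_distrib_mat[of _ n n _ _ n] c)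
  also have "\<dots> = (g * (h * A * h') * g' + g * (map_mat z_deriv h * h') * g')
      + map_mat z_deriv g * g'"
    using A C D G(1) H(1)
    by (simp add: assoc_mult_mat[of _ n n _ n _ n] assoc_add_mat[of _ n n]
        comm_add_mat[of "map_mat z_deriv g * g'" n n])
  also have "\<dots> = g * (h * A * h' + map_mat z_deriv h * h') * g' + map_mat z_deriv g * g'"
    using A C D G(1) H(1)
    by (simp add: add_mult_distrib_mat[of _ n n _ _ n] mult_add_distrib_mat[of _ n n _ n])
  also have "\<dots> = gauge g (gauge h A)"
    by (simp add: gauge_def g'_def h'_def)
  finally show ?thesis ..
qed

lemma gauge_equivalent_refl: "A \<in> carrier_mat n n \<Longrightarrow> gauge_equivalent n A A"
  using SL_one gauge_one unfolding gauge_equivalent_def by metis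

lemma gauge_equivalent_sym:
  assumes "A \<in> carrier_mat n n" "gauge_equivalent n A B"
  shows "gauge_equivalent n B A"
proof -
  obtain g where g: "g \<in> SL n" "B = gauge g A" using assms by (auto simp: gauge_equivalent_def)
  have "gauge (the (mat_inverse g)) B = A"
    using gauge_mult[OF assms(1) SL_mat_inverse[OF g(1)] g(1)] SL_inverse[OF g(1)]
      gauge_one[OF assms(1)] g(2) by simp
  with SL_mat_inverse[OF g(1)] show ?thesis unfolding gauge_equivalent_def by metis
qed

lemma gauge_equivalent_trans:
  assumes "A \<in> carrier_mat n n" "gauge_equivalent n A B" "gauge_equivalent n B C"
  shows "gauge_equivalent n A C"
  using assms gauge_mult SL_mult unfolding gauge_equivalent_def by metis

lemma pullback_carrier: "A \<in> carrier_mat n n \<Longrightarrow> pullback m A \<in> carrier_mat n n"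
  by (simp add: pullback_def)

lemma fls_compose_power_sum:
  "fls_compose_power (sum f A) m = (\<Sum>x\<in>A. fls_compose_power (f x) m)"
  by (induction A rule: infinite_finite_induct) simp_all

lemma fls_compose_power_of_nat: "m \<ge> 1 \<Longrightarrow> fls_compose_power (of_nat l) m = of_nat l"
  using fls_compose_power_const_left[of m "of_nat l"] by (simp add: fls_of_nat)

lemma pullback_pullback:
  assumes "l \<ge> 1" "m \<ge> 1"
  shows "pullback l (pullback m A) = pullback (l * m) A"
proof -
  have "fls_compose_power (fls_compose_power f m) l = fls_compose_power f (l * m)"
    for f :: "'a fls"
    using assms
    by (intro fls_eqI) (auto simp: fls_nth_compose_power zdiv_zmult2_eq mult_dvd_mono
        dvd_mult_left dest: dvd_mult_left elim!: dvdE)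
  then show ?thesis using assms
    by (intro eq_matI) (auto simp: pullback_def fls_compose_power_of_nat)
qed

lemma z_deriv_compose_power:
  fixes f :: "'k::field fls"
  assumes "m \<ge> 1"
  shows "z_deriv (fls_compose_power f m) = of_nat m * fls_compose_power (z_deriv f) m"
proof (rule fls_eqI)
  have z: "fls_nth (z_deriv f) i = of_int i * fls_nth f i" for f :: "'k fls" and i
    by (simp add: z_deriv_def fls_X_times_conv_shift)
  fix i
  show "fls_nth (z_deriv (fls_compose_power f m)) i =
      fls_nth (of_nat m * fls_compose_power (z_deriv f) m) i"
    using assms by (auto simp: z fls_nth_compose_power fls_of_nat elim!: dvdE)
qed

lemma compose_power_mult_mat:
  fixes A B :: "'k::field fls mat"
  assumes "A \<in> carrier_mat n n" "B \<in> carrier_mat n n"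
  shows "map_mat (\<lambda>f. fls_compose_power f m) (A * B) =
    map_mat (\<lambda>f. fls_compose_power f m) A * map_mat (\<lambda>f. fls_compose_power f m) B"
  using assms by (intro eq_matI) (auto simp: scalar_prod_def fls_compose_power_sum)

lemma pullback_gauge:
  fixes A B :: "'k::field fls mat"
  assumes A: "A \<in> carrier_mat n n" and m: "m \<ge> 1" and "gauge_equivalent n A B"
  shows "gauge_equivalent n (pullback m A) (pullback m B)"
proof -
  obtain g where g: "g \<in> SL n" and B: "B = gauge g A"
    using assms by (auto simp: gauge_equivalent_def)
  define c where "c = (\<lambda>f::'k fls. fls_compose_power f m)"
  define g' where "g' = the (mat_inverse g)"
  note I = SL_inverse[OF g, folded g'_def]
  have gc: "g \<in> carrier_mat n n" using g by (simp add: SL_def)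
  have cm: "map_mat c (X * Y) = map_mat c X * map_mat c Y"
    if "X \<in> carrier_mat n n" "Y \<in> carrier_mat n n" for X Y
    using compose_power_mult_mat[OF that] by (simp add: c_def)
  have one: "map_mat c (1\<^sub>m n) = 1\<^sub>m n" using m by (intro eq_matI) (auto simp: c_def)
  interpret c: comm_ring_hom c
    using m by unfold_locales (auto simp: c_def)
  have s: "map_mat c g \<in> SL n"
    using g by (auto simp: SL_def)
  have i: "the (mat_inverse (map_mat c g)) = map_mat c g'"
    using mat_inverse_unique[OF s, of "map_mat c g'"] cm[OF I(1) gc] I one by simp
  have dz: "map_mat z_deriv (map_mat c g) = of_nat m \<cdot>\<^sub>m map_mat c (map_mat z_deriv g)"
    by (intro eq_matI) (auto simp: c_def z_deriv_compose_power[OF m])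
  have zg: "map_mat z_deriv g \<in> carrier_mat n n" using gc by simp
  have pA: "pullback m A = of_nat m \<cdot>\<^sub>m map_mat c A" by (simp add: pullback_def c_def)
  have cc: "map_mat c g \<in> carrier_mat n n" "map_mat c A \<in> carrier_mat n n"
    "map_mat c g' \<in> carrier_mat n n" "map_mat c (map_mat z_deriv g) \<in> carrier_mat n n"
    using gc A I by auto
  have "map_mat c (g * A * g' + map_mat z_deriv g * g') =
      map_mat c (g * A * g') + map_mat c (map_mat z_deriv g * g')"
    using gc A I zg by (intro eq_matI) (auto simp: c.hom_add)
  then have "pullback m B = of_nat m \<cdot>\<^sub>m
      (map_mat c g * map_mat c A * map_mat c g' + map_mat c (map_mat z_deriv g) * map_mat c g')"
    using gc A I zg by (simp add: pullback_def B gauge_def cm flip: c_def g'_def)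
  also have "\<dots> = gauge (map_mat c g) (pullback m A)"
    unfolding gauge_def i dz pA using cc
    by (simp add: mult_smult_distrib[of _ n n _ n] mult_smult_assoc_mat[of _ n n _ n]
        add_smult_distrib_left_mat[of _ n n])
  finally show ?thesis using s by (auto simp: gauge_equivalent_def)
qed

lemma equiv_relationship_on:
  assumes "S \<subseteq> sl n"
  shows "equiv S (relationship_on n S)"
proof -
  have car: "A \<in> carrier_mat n n" if "A \<in> S" for A using that assms by (auto simp: sl_def)
  have p1: "pullback 1 A = A" for A :: "'a fls mat"
    by (intro eq_matI) (auto simp: pullback_def intro!: fls_eqI simp: fls_nth_compose_power)
  have p: "gauge_equivalent n (pullback 1 A) (pullback 1 A)" if "A \<in> S" for A
    using gauge_equivalent_refl[OF car[OF that]] by (simp only: p1)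
  show ?thesis
  proof (rule equivI)
    show "relationship_on n S \<subseteq> S \<times> S" by (auto simp: relationship_on_def)
    show "refl_on S (relationship_on n S)"
      using p by (intro refl_onI) (auto simp: relationship_on_def related_def)
    show "sym (relationship_on n S)"
      by (rule symI)
        (auto simp: relationship_on_def related_def intro: gauge_equivalent_sym
          pullback_carrier car)
    show "trans (relationship_on n S)"
    proof (rule transI)
      fix A B C assume "(A, B) \<in> relationship_on n S" "(B, C) \<in> relationship_on n S"
      then obtain l m where S: "A \<in> S" "B \<in> S" "C \<in> S" and l: "l \<ge> 1" and m: "m \<ge> 1"
        and ge: "gauge_equivalent n (pullback l A) (pullback l B)"
          "gauge_equivalent n (pullback m B) (pullback m C)"
        by (auto simp: relationship_on_def related_def)
      have "gauge_equivalent n (pullback (m * l) A) (pullback (m * l) B)"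
        "gauge_equivalent n (pullback (l * m) B) (pullback (l * m) C)"
        using pullback_gauge[OF _ m ge(1)] pullback_gauge[OF _ l ge(2)] l m S
        by (simp_all add: pullback_pullback pullback_carrier car)
      then have "gauge_equivalent n (pullback (m * l) A) (pullback (m * l) C)"
        using gauge_equivalent_trans pullback_carrier[OF car[OF S(1)]]
        by (metis mult.commute)
      moreover have "m * l \<ge> 1" using l m by simp
      ultimately show "(A, C) \<in> relationship_on n S"
        using S unfolding relationship_on_def related_def by blast
    qed
  qed
qed

end

theory Submission
  imports Defs
    "Jordan_Normal_Form.Jordan_Normal_Form_Existence"
    "Jordan_Normal_Form.Jordan_Normal_Form_Uniqueness"
begin

text \<open>
  The group that makes the classification clean is \<open>GL\<^sub>n(K)\<close>, not \<open>SL\<^sub>n(K)\<close>: it contains the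
  diagonal matrices of powers of \<open>z\<close>, which shift eigenvalues by integers. Gauge equivalence under
  \<open>GL\<^sub>n(K)\<close> is \<open>gl_equivalent\<close>, an intertwining relation \<open>B g = g A + z g'\<close>. Nothing is lost:
  taking traces in this relation gives \<open>z (det g)' = (tr B - tr A) det g\<close>, so between trace-free
  connections \<open>det g\<close> is a nonzero constant, and dividing \<open>g\<close> by an \<open>n\<close>-th root of it puts it in
  \<open>SL\<^sub>n(K)\<close> (\<open>gl_equivalent_imp_gauge_equivalent\<close>).

  Surjectivity. Let \<open>B\<close> have power series entries. If \<open>l\<close> is an eigenvalue of \<open>B(0)\<close> such that no
  \<open>l + j\<close> with \<open>j \<ge> 1\<close> is one, the equation \<open>B v - z v' = l v\<close> can be solved for a power series
  \<open>v\<close> with \<open>v(0)\<close> an eigenvector, because the coefficient of \<open>z\<^sup>j\<close> is determined by the invertible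
  matrix \<open>B(0) - (l + j)\<close>. Taking \<open>v\<close> as the first basis vector leaves a connection with power
  series entries in dimension \<open>n - 1\<close> (\<open>deflation\<close>), and induction on \<open>n\<close> yields a
  constant upper triangular matrix. No resonance occurs in the induction, since \<open>l\<close> may be moved
  within its class modulo \<open>\<int>\<close> until it differs from no other diagonal entry by a nonzero integer
  (\<open>power_series_connection_normal_form\<close>). Passing to the Jordan form \<open>J\<close> of this matrix, the
  trace formula shows that \<open>tr J\<close> is an integer. After pullback along \<open>z \<mapsto> z\<^sup>n\<close> the scalar
  \<open>tr J\<close> can be gauged away, and this replaces \<open>J\<close> by the trace-free Jordan matrix
  \<open>J - (tr J) / n\<close>.

  Classification. If \<open>m q\<close> is an integer then after pullback along \<open>z \<mapsto> z\<^sup>m\<close> the power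
  \<open>z\<^sup>m\<^sup>q\<close>, a scalar on a Jordan block, shifts the eigenvalue of this block by \<open>q\<close>
  (\<open>gl_equivalent_jordan_shift\<close>). Hence Jordan matrices that differ rationally are related.
  Conversely, shift all eigenvalues of two related Jordan matrices to fixed representatives of
  their classes modulo \<open>\<rat>\<close>. The eigenvalues are then equal or have an irrational difference, so a
  gauge transformation between the two can only have a constant term
  (\<open>gl_equivalent_constant_imp_similar\<close>). The shifted matrices are thus similar over the constants,
  and uniqueness of the Jordan normal form matches their blocks.
\<close>

(* The symbols $ and $$ are left to the entries of vectors and matrices. *)
no_notation fps_nth (infixl "$" 75) and fls_nth (infixl "$$" 75)

section \<open>Gauge equivalence under the general linear group\<close>

text \<open>
  The relation \<open>B = g A g\<^sup>-\<^sup>1 + z g' g\<^sup>-\<^sup>1\<close> multiplied by \<open>g\<close> from the right; in this form it needs no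
  inverse and can be read off coefficient by coefficient.
\<close>
definition gl_equivalent :: "nat \<Rightarrow> 'k::field fls mat \<Rightarrow> 'k fls mat \<Rightarrow> bool" where
  "gl_equivalent n A B \<longleftrightarrow>
     (\<exists>g \<in> carrier_mat n n. det g \<noteq> 0 \<and> B * g = g * A + map_mat z_deriv g)"

lemma nonzero_det_inverse:
  fixes g :: "'a::field mat"
  assumes "g \<in> carrier_mat n n" "det g \<noteq> 0"
  obtains h where "h \<in> carrier_mat n n" "h * g = 1\<^sub>m n" "g * h = 1\<^sub>m n" "det h \<noteq> 0"
proof -
  obtain h where h: "h \<in> carrier_mat n n" "h * g = 1\<^sub>m n" "g * h = 1\<^sub>m n"
    using det_non_zero_imp_unit[OF assms, of "()"] by (auto simp: Units_def ring_mat_def)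
  have "det h * det g = 1" using det_mult[OF h(1) assms(1)] h by simp
  then have "det h \<noteq> 0" by auto
  with h that show ?thesis by blast
qed

lemma gl_equivalent_trans:
  assumes A: "A \<in> carrier_mat n n" and B: "B \<in> carrier_mat n n" and C: "C \<in> carrier_mat n n"
    and "gl_equivalent n A B" "gl_equivalent n B C"
  shows "gl_equivalent n A C"
proof -
  obtain g h where g: "g \<in> carrier_mat n n" "det g \<noteq> 0" "B * g = g * A + map_mat z_deriv g"
    and h: "h \<in> carrier_mat n n" "det h \<noteq> 0" "C * h = h * B + map_mat z_deriv h"
    using assms by (auto simp: gl_equivalent_def)
  have D: "map_mat z_deriv g \<in> carrier_mat n n" "map_mat z_deriv h \<in> carrier_mat n n"
    using g h by auto
  note as = assoc_mult_mat[of _ n n _ n _ n]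
  have "C * (h * g) = (h * B + map_mat z_deriv h) * g"
    using C g(1) h(1) by (simp add: as flip: h(3))
  also have "\<dots> = h * (B * g) + map_mat z_deriv h * g"
    using B g(1) h(1) D by (simp add: add_mult_distrib_mat[of _ n n _ _ n] as)
  also have "\<dots> = h * g * A + (h * map_mat z_deriv g + map_mat z_deriv h * g)"
    unfolding g(3) using A g(1) h(1) D
    by (simp add: mult_add_distrib_mat[of _ n n _ n] assoc_add_mat[of _ n n] as)
  also have "h * map_mat z_deriv g + map_mat z_deriv h * g = map_mat z_deriv (h * g)"
    unfolding z_deriv_mult_mat[OF h(1) g(1)] using g(1) h(1) D
    by (intro comm_add_mat[of _ n n]) auto
  finally have "C * (h * g) = h * g * A + map_mat z_deriv (h * g)" .
  moreover have "det (h * g) \<noteq> 0" using g h det_mult[OF h(1) g(1)] by simp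
  ultimately show ?thesis using g h unfolding gl_equivalent_def by auto
qed

lemma gl_equivalent_sym:
  assumes A: "A \<in> carrier_mat n n" and B: "B \<in> carrier_mat n n" and "gl_equivalent n A B"
  shows "gl_equivalent n B A"
proof -
  obtain g where g: "g \<in> carrier_mat n n" "det g \<noteq> 0" "B * g = g * A + map_mat z_deriv g"
    using assms by (auto simp: gl_equivalent_def)
  obtain h where h: "h \<in> carrier_mat n n" "h * g = 1\<^sub>m n" "g * h = 1\<^sub>m n" "det h \<noteq> 0"
    using nonzero_det_inverse[OF g(1,2)] by blast
  note as = assoc_mult_mat[of _ n n _ n _ n]
  have D: "map_mat z_deriv g \<in> carrier_mat n n" "map_mat z_deriv h \<in> carrier_mat n n"
    using g h by auto
  have Z: "map_mat z_deriv h * g + h * map_mat z_deriv g = 0\<^sub>m n n"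
  proof -
    have "map_mat z_deriv (h * g) = 0\<^sub>m n n"
      unfolding h by (intro eq_matI) (auto simp: z_deriv_simps)
    then show ?thesis using z_deriv_mult_mat[OF h(1) g(1)] by simp
  qed
  have "h * B + map_mat z_deriv h = h * (B * g) * h + map_mat z_deriv h * (g * h)"
    using B g(1) h D by (simp add: as)
  also have "h * (B * g) * h = (h * g * A + h * map_mat z_deriv g) * h"
    unfolding g(3) using A g(1) h(1) D by (simp add: as mult_add_distrib_mat[of _ n n _ n])
  also have "\<dots> + map_mat z_deriv h * (g * h)
      = A * h + (h * map_mat z_deriv g + map_mat z_deriv h * g) * h"
    using A g h(1) D unfolding h(2)
    by (simp add: as add_mult_distrib_mat[of _ n n _ _ n] assoc_add_mat[of _ n n])
  also have "h * map_mat z_deriv g + map_mat z_deriv h * g = 0\<^sub>m n n"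
    using Z D g(1) h(1) by (simp add: comm_add_mat[of "h * map_mat z_deriv g" n n])
  finally have "A * h = h * B + map_mat z_deriv h" using A h by simp
  with h show ?thesis by (auto simp: gl_equivalent_def)
qed

lemma gauge_equivalent_imp_gl:
  assumes A: "A \<in> carrier_mat n n" and "gauge_equivalent n A B"
  shows "gl_equivalent n A B"
proof -
  obtain g where g: "g \<in> SL n" and B: "B = gauge g A" using assms by (auto simp: gauge_equivalent_def)
  define h where "h = the (mat_inverse g)"
  note h = SL_inverse[OF g, folded h_def]
  have gc: "g \<in> carrier_mat n n" "det g \<noteq> 0" using g by (auto simp: SL_def)
  have "B * g = g * A * (h * g) + map_mat z_deriv g * (h * g)"
    unfolding B gauge_def h_def[symmetric] using A gc h(1)
    by (simp add: add_mult_distrib_mat[of _ n n _ _ n] assoc_mult_mat[of _ n n _ n _ n])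
  then show ?thesis using gc A h unfolding gl_equivalent_def by (intro bexI[of _ g]) auto
qed

lemma intertwiner_imp_gauge_equivalent:
  assumes A: "A \<in> carrier_mat n n" and B: "B \<in> carrier_mat n n" and g: "g \<in> SL n"
    and eq: "B * g = g * A + map_mat z_deriv g"
  shows "gauge_equivalent n A B"
proof -
  define h where "h = the (mat_inverse g)"
  note h = SL_inverse[OF g, folded h_def]
  have gc: "g \<in> carrier_mat n n" using g by (auto simp: SL_def)
  have "gauge g A = (g * A + map_mat z_deriv g) * h"
    unfolding gauge_def h_def[symmetric] using A gc h(1)
    by (simp add: add_mult_distrib_mat[of _ n n _ _ n])
  also have "\<dots> = B * (g * h)" using B gc h(1) by (simp add: eq[symmetric])
  finally have "gauge g A = B" using h B by simp
  then show ?thesis using g by (auto simp: gauge_equivalent_def)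
qed

section \<open>Logarithmic derivative of the determinant\<close>

lemma z_deriv_nth: "fls_nth (z_deriv f) i = of_int i * fls_nth f i"
  by (simp add: z_deriv_def fls_X_times_conv_shift)

text \<open>
  The operator \<open>z d/dz\<close> multiplies the coefficient of \<open>z\<^sup>i\<close> by \<open>i\<close>, so in characteristic zero its
  eigenvalues are the integers and each eigenspace is spanned by one monomial.
\<close>
lemma z_deriv_eq_scale_imp_monomial:
  fixes f :: "'k::field_char_0 fls"
  assumes "z_deriv f = fls_const c * f" "f \<noteq> 0"
  obtains N a where "a \<noteq> 0" "c = of_int N" "f = fls_const a * fls_X_intpow N"
proof -
  have e: "(of_int i - c) * fls_nth f i = 0" for i
    using arg_cong[OF assms(1), of "\<lambda>h. fls_nth h i"] by (simp add: z_deriv_nth algebra_simps)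
  obtain N where N: "fls_nth f N \<noteq> 0" using assms(2) by (meson fls_nonzeroI nth_fls_subdegree_nonzero)
  then have c: "c = of_int N" using e[of N] by simp
  have "fls_nth f i = 0" if "i \<noteq> N" for i using e[of i] that unfolding c by simp
  then have "f = fls_const (fls_nth f N) * fls_X_intpow N"
    by (intro fls_eqI) (auto simp: fls_X_intpow_times_conv_shift)
  with that N c show ?thesis by blast
qed

lemma z_deriv_prod:
  "finite A \<Longrightarrow> z_deriv (prod f A) = (\<Sum>i\<in>A. z_deriv (f i) * prod f (A - {i}))"
proof (induction A rule: finite_induct)
  case (insert x A)
  have "(\<Sum>i\<in>A. z_deriv (f i) * prod f (insert x A - {i}))
      = (\<Sum>i\<in>A. f x * (z_deriv (f i) * prod f (A - {i})))"
    using insert by (intro sum.cong) (auto simp: insert_Diff_if mult.left_commute)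
  then show ?case using insert
    by (simp add: z_deriv_simps sum_distrib_left)
qed (simp add: z_deriv_simps)

lemma z_deriv_of_int [simp]: "z_deriv (of_int i) = 0"
  by (simp add: z_deriv_def)

text \<open>
  Jacobi's formula. By the Leibniz formula the derivative of the determinant is the sum over all rows
  \<open>i\<close> of the determinant with row \<open>i\<close> differentiated, called \<open>R i\<close> below. Expanding \<open>R i\<close> along row
  \<open>i\<close> only uses cofactors of the original matrix.
\<close>
lemma z_deriv_det:
  assumes A: "A \<in> carrier_mat n n"
  shows "z_deriv (det A) = mat_trace (map_mat z_deriv A * adj_mat A)"
proof -
  define R where "R i = mat n n (\<lambda>(k, j). if k = i then z_deriv (A $$ (i, j)) else A $$ (k, j))" for i
  have "z_deriv (det A) = (\<Sum>p | p permutes {0..<n}. signof p *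
      (\<Sum>i = 0..<n. z_deriv (A $$ (i, p i)) * (\<Prod>k \<in> {0..<n} - {i}. A $$ (k, p k))))"
    unfolding det_def'[OF A] z_deriv_sum
    by (intro sum.cong refl) (simp add: z_deriv_simps z_deriv_prod)
  also have "\<dots> = (\<Sum>p | p permutes {0..<n}. \<Sum>i = 0..<n. signof p * (\<Prod>k = 0..<n. R i $$ (k, p k)))"
  proof (intro sum.cong refl, unfold sum_distrib_left, intro sum.cong refl)
    fix p i assume p: "p \<in> {p. p permutes {0..<n}}" and i: "i \<in> {0..<n}"
    have pk: "p k < n" if "k < n" for k using p that permutes_in_image[of p "{0..<n}" k] by auto
    have "(\<Prod>k = 0..<n. R i $$ (k, p k)) = R i $$ (i, p i) * (\<Prod>k \<in> {0..<n} - {i}. R i $$ (k, p k))"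
      using i by (subst prod.remove[of _ i]) auto
    also have "(\<Prod>k \<in> {0..<n} - {i}. R i $$ (k, p k)) = (\<Prod>k \<in> {0..<n} - {i}. A $$ (k, p k))"
      using pk by (intro prod.cong) (auto simp: R_def)
    finally show "signof p * (z_deriv (A $$ (i, p i)) * (\<Prod>k \<in> {0..<n} - {i}. A $$ (k, p k)))
      = signof p * (\<Prod>k = 0..<n. R i $$ (k, p k))"
      using i pk by (simp add: R_def)
  qed
  also have "\<dots> = (\<Sum>i = 0..<n. det (R i))"
    by (subst sum.swap) (intro sum.cong refl, subst det_def'[of _ n], auto simp: R_def)
  also have "\<dots> = (\<Sum>i = 0..<n. \<Sum>j<n. z_deriv (A $$ (i, j)) * cofactor A i j)"
  proof (intro sum.cong refl)
    fix i assume i: "i \<in> {0..<n}"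
    have "mat_delete (R i) i j = mat_delete A i j" for j
      using A i by (intro eq_matI) (auto simp: mat_delete_def R_def)
    then have "cofactor (R i) i j = cofactor A i j" for j by (simp add: cofactor_def)
    moreover have "det (R i) = (\<Sum>j<n. R i $$ (i, j) * cofactor (R i) i j)"
      using i by (intro laplace_expansion_row) (auto simp: R_def)
    ultimately show "det (R i) = (\<Sum>j<n. z_deriv (A $$ (i, j)) * cofactor A i j)"
      using i by (simp add: R_def)
  qed
  also have "\<dots> = mat_trace (map_mat z_deriv A * adj_mat A)"
    using A by (auto simp: mat_trace_def scalar_prod_def adj_mat_def atLeast0LessThan intro!: sum.cong)
  finally show ?thesis .
qed

lemma mat_trace_add:
  assumes "A \<in> carrier_mat n n" "B \<in> carrier_mat n n"
  shows "mat_trace (A + B) = mat_trace A + mat_trace (B :: 'a::comm_ring_1 mat)"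
  using assms by (simp add: mat_trace_def sum.distrib)

lemma mat_trace_smult:
  assumes "A \<in> carrier_mat n n"
  shows "mat_trace (c \<cdot>\<^sub>m A) = c * mat_trace (A :: 'a::comm_ring_1 mat)"
  using assms by (simp add: mat_trace_def sum_distrib_left)

lemma mat_trace_mult_commute:
  assumes "A \<in> carrier_mat n n" "B \<in> carrier_mat n n"
  shows "mat_trace (A * B) = mat_trace (B * A :: 'a::comm_ring_1 mat)"
proof -
  have "mat_trace (A * B) = (\<Sum>i<n. \<Sum>j<n. A $$ (i, j) * B $$ (j, i))"
    using assms by (auto simp: mat_trace_def scalar_prod_def atLeast0LessThan)
  also have "\<dots> = (\<Sum>j<n. \<Sum>i<n. B $$ (j, i) * A $$ (i, j))"
    by (subst sum.swap) (simp add: mult.commute)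
  also have "\<dots> = mat_trace (B * A)"
    using assms by (auto simp: mat_trace_def scalar_prod_def atLeast0LessThan)
  finally show ?thesis .
qed

text \<open>
  Multiply the intertwining relation by the adjugate of \<open>g\<close> and take traces: the terms of \<open>A\<close> and
  \<open>B\<close> contribute \<open>det g\<close> times their trace, and the derivative term is Jacobi's formula.
\<close>
lemma z_deriv_det_intertwiner:
  fixes A B g :: "'k::field fls mat"
  assumes A: "A \<in> carrier_mat n n" and B: "B \<in> carrier_mat n n" and g: "g \<in> carrier_mat n n"
    and eq: "B * g = g * A + map_mat z_deriv g"
  shows "z_deriv (det g) = (mat_trace B - mat_trace A) * det g"
proof -
  define a where "a = adj_mat g"
  note adj = adj_mat[OF g, folded a_def]
  have D: "map_mat z_deriv g \<in> carrier_mat n n" using g by simp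
  have "B * (g * a) = (g * A + map_mat z_deriv g) * a"
    using assoc_mult_mat[OF B g adj(1)] by (simp only: eq)
  also have "\<dots> = g * A * a + map_mat z_deriv g * a"
    using A g adj(1) D by (simp add: add_mult_distrib_mat[of _ n n _ _ n])
  finally have "B * (g * a) = g * A * a + map_mat z_deriv g * a" .
  then have "mat_trace (B * (g * a)) = mat_trace (g * (A * a)) + mat_trace (map_mat z_deriv g * a)"
    using A g adj(1) by (simp add: mat_trace_add[of _ n] assoc_mult_mat[of _ n n _ n _ n])
  also have "mat_trace (g * (A * a)) = mat_trace (A * (a * g))"
    using A g adj(1) by (simp add: mat_trace_mult_commute[of g n] assoc_mult_mat[of _ n n _ n _ n])
  finally have "det g * mat_trace B = det g * mat_trace A + z_deriv (det g)"
    using A B g adj mult_smult_distrib[OF A one_carrier_mat] mult_smult_distrib[OF B one_carrier_mat]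
    by (simp add: z_deriv_det a_def mat_trace_smult)
  then show ?thesis by (simp add: algebra_simps)
qed

lemma mat_trace_dlog:
  assumes "X \<in> carrier_mat n n"
  shows "mat_trace (dlog X) = fls_const (mat_trace X)"
proof -
  have "fls_const (a + b) = fls_const a + fls_const b" for a b :: 'a
    by (intro fls_eqI) simp
  then have "fls_const (\<Sum>i\<in>S. f i) = (\<Sum>i\<in>S. fls_const (f i))" for S :: "nat set" and f :: "nat \<Rightarrow> 'a"
    by (induction S rule: infinite_finite_induct) auto
  then show ?thesis using assms by (simp add: mat_trace_def dlog_def)
qed

lemma z_deriv_const_mult: "z_deriv (fls_const c * f) = fls_const c * z_deriv f"
  by (intro fls_eqI) (simp add: z_deriv_nth)

text \<open>
  For trace-free connections the determinant of a gauge transformation is killed by \<open>z d/dz\<close>, hence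
  constant, and a constant scalar matrix commutes with everything in sight.
\<close>
lemma gl_equivalent_imp_gauge_equivalent:
  fixes A B :: "'k::{alg_closed_field, field_char_0} fls mat"
  assumes n: "n \<ge> 1" and A: "A \<in> sl n" and B: "B \<in> sl n" and "gl_equivalent n A B"
  shows "gauge_equivalent n A B"
proof -
  have c: "A \<in> carrier_mat n n" "B \<in> carrier_mat n n" and t: "mat_trace A = 0" "mat_trace B = 0"
    using A B by (auto simp: sl_def)
  obtain g where g: "g \<in> carrier_mat n n" "det g \<noteq> 0" "B * g = g * A + map_mat z_deriv g"
    using assms by (auto simp: gl_equivalent_def)
  have "z_deriv (det g) = fls_const 0 * det g" 
    using z_deriv_det_intertwiner[OF c g(1,3)] t by simp
  then obtain a where a: "a \<noteq> 0" "det g = fls_const a"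
    using z_deriv_eq_scale_imp_monomial[OF _ g(2)] by (metis fls_shift_0 minus_zero mult.right_neutral of_int_eq_0_iff)
  obtain b where b: "b ^ n = inverse a" using nth_root_exists[of n "inverse a"] n by auto
  define h where "h = fls_const b \<cdot>\<^sub>m g"
  have "det h = 1" using a b g(1) by (simp add: h_def flip: fls_const_power)
  then have h: "h \<in> SL n" using g by (simp add: SL_def h_def)
  have "map_mat z_deriv h = fls_const b \<cdot>\<^sub>m map_mat z_deriv g"
    using g by (intro eq_matI) (auto simp: h_def z_deriv_const_mult)
  then have "B * h = h * A + map_mat z_deriv h"
    using g c by (simp add: h_def mult_smult_distrib[of _ n n _ n] mult_smult_assoc_mat[of _ n n _ n]
        add_smult_distrib_left_mat[of _ n n])
  then show ?thesis using intertwiner_imp_gauge_equivalent[OF c h] by simp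
qed

section \<open>Splitting off a line from a connection with power series entries\<close>

definition bordered :: "'a::zero \<Rightarrow> 'a mat \<Rightarrow> 'a mat \<Rightarrow> 'a mat" where
  "bordered l W C = four_block_mat (mat 1 1 (\<lambda>_. l)) W (0\<^sub>m (dim_row C) 1) C"

lemma bordered_carrier [simp]: "C \<in> carrier_mat n n \<Longrightarrow> bordered l W C \<in> carrier_mat (Suc n) (Suc n)"
  by (auto simp: bordered_def)

lemma index_bordered [simp]:
  assumes "i < Suc (dim_row C)" "j < Suc (dim_col C)"
  shows "bordered l W C $$ (i, j) = (if i = 0 then if j = 0 then l else W $$ (0, j - 1)
    else if j = 0 then 0 else C $$ (i - 1, j - 1))"
  using assms by (auto simp: bordered_def)

lemma bordered_mult:
  fixes a b :: "'a::comm_ring_1"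
  assumes "U \<in> carrier_mat 1 n" "W \<in> carrier_mat 1 n" "A \<in> carrier_mat n n" "B \<in> carrier_mat n n"
  shows "bordered a U A * bordered b W B = bordered (a * b) (a \<cdot>\<^sub>m W + U * B) (A * B)"
proof -
  have "mat 1 1 (\<lambda>_. a) * mat 1 1 (\<lambda>_. b) + U * 0\<^sub>m n 1 = mat 1 1 (\<lambda>_. a * b)"
    using assms by (intro eq_matI) (auto simp: scalar_prod_def)
  moreover have "mat 1 1 (\<lambda>_. a) * W = a \<cdot>\<^sub>m W"
    using assms by (intro eq_matI) (auto simp: scalar_prod_def)
  moreover have "0\<^sub>m n 1 * mat 1 1 (\<lambda>_. b) + A * 0\<^sub>m n 1 = 0\<^sub>m n 1"
    using assms by (intro eq_matI) (auto simp: scalar_prod_def)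
  moreover have "0\<^sub>m n 1 * W + A * B = A * B"
    using assms by (intro eq_matI) (auto simp: scalar_prod_def)
  ultimately show ?thesis
    using assms mult_four_block_mat[of "mat 1 1 (\<lambda>_. a)" 1 1 U n "0\<^sub>m n 1" n A
        "mat 1 1 (\<lambda>_. b)" 1 W n "0\<^sub>m n 1" B]
    by (simp add: bordered_def)
qed

lemma bordered_add:
  fixes a b :: "'a::comm_ring_1"
  assumes "U \<in> carrier_mat 1 n" "W \<in> carrier_mat 1 n" "A \<in> carrier_mat n n" "B \<in> carrier_mat n n"
  shows "bordered a U A + bordered b W B = bordered (a + b) (U + W) (A + B)"
  using assms by (intro eq_matI) (auto simp: bordered_def)

lemma map_mat_bordered:
  assumes "W \<in> carrier_mat 1 n" "C \<in> carrier_mat n n" "f 0 = 0"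
  shows "map_mat f (bordered a W C) = bordered (f a) (map_mat f W) (map_mat f C)"
  using assms by (intro eq_matI) (auto simp: bordered_def)

lemma det_bordered:
  assumes "W \<in> carrier_mat 1 n" "C \<in> carrier_mat n n"
  shows "det (bordered a W C) = a * det (C :: 'a::idom mat)"
proof -
  have "det (mat 1 1 (\<lambda>_. a)) = a" by (simp add: det_single)
  then show ?thesis using assms
    by (simp add: bordered_def det_four_block_mat_lower_left_zero_col[OF _ assms(1) _ assms(2)])
qed

lemma z_deriv_fps_to_fls: "z_deriv (fps_to_fls f) = fps_to_fls (fps_X * fps_deriv f)"
  by (simp add: z_deriv_def fls_deriv_fps_to_fls fls_times_fps_to_fls)

lemma fps_to_fls_sum: "fps_to_fls (sum f A) = (\<Sum>x\<in>A. fps_to_fls (f x))"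
  by (induction A rule: infinite_finite_induct) auto

lemma char_matrix_mult_vec:
  assumes A: "A \<in> carrier_mat n n" and x: "x \<in> carrier_vec n"
  shows "char_matrix A e *\<^sub>v x = A *\<^sub>v x - e \<cdot>\<^sub>v x"
proof -
  have "((-e) \<cdot>\<^sub>m 1\<^sub>m n) *\<^sub>v x = (-e) \<cdot>\<^sub>v x"
    using x by (intro eq_vecI)
      (auto simp: scalar_prod_def if_distrib[of "\<lambda>x. x * _"] if_distrib[of "\<lambda>x. _ * x"] cong: if_cong)
  then have "char_matrix A e *\<^sub>v x = A *\<^sub>v x + (-e) \<cdot>\<^sub>v x"
    using A x by (simp add: char_matrix_def add_mult_distrib_mat_vec[of _ n n])
  then show ?thesis using A x by (intro eq_vecI) auto
qed

text \<open>
  The method of Frobenius: in \<open>B v - z v' = l v\<close> the coefficient \<open>v\<^sub>j\<close> satisfies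
  \<open>(B(0) - (l + j)) v\<^sub>j = rhs\<close>, where \<open>rhs\<close> only involves earlier coefficients. The maximality
  assumption says that this matrix is invertible for \<open>j \<ge> 1\<close>.
\<close>
lemma power_series_eigenvector:
  fixes B :: "'k::field fps mat"
  assumes B: "B \<in> carrier_mat n n"
    and v0: "eigenvector (map_mat (\<lambda>f. fps_nth f 0) B) v0 l"
    and max: "\<And>j. j \<ge> 1 \<Longrightarrow> \<not> eigenvalue (map_mat (\<lambda>f. fps_nth f 0) B) (l + of_nat j)"
  obtains V where "\<And>r. r < n \<Longrightarrow> fps_nth (V r) 0 = v0 $ r"
    "\<And>r. r < n \<Longrightarrow> (\<Sum>c<n. B $$ (r, c) * V c) = fps_const l * V r + fps_X * fps_deriv (V r)"
proof -
  define B0 where "B0 = map_mat (\<lambda>f. fps_nth f 0) B"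
  have B0: "B0 \<in> carrier_mat n n" using B by (simp add: B0_def)
  have v0': "v0 \<in> carrier_vec n" "B0 *\<^sub>v v0 = l \<cdot>\<^sub>v v0"
    using v0 B0 by (auto simp: eigenvector_def B0_def)
  define rhs where "rhs v j = vec n (\<lambda>r. - (\<Sum>c<n. \<Sum>i=1..j. fps_nth (B $$ (r, c)) i * v (j - i) $ c))"
    for v :: "nat \<Rightarrow> 'k vec" and j
  define P where "P v j x \<longleftrightarrow> x \<in> carrier_vec n \<and> (j = 0 \<longrightarrow> x = v0) \<and>
      (j \<ge> 1 \<longrightarrow> char_matrix B0 (l + of_nat j) *\<^sub>v x = rhs v j)" for v j x
  have "\<exists>v. \<forall>j. P v j (v j)"
  proof (rule dependent_wellorder_choice)
    fix r and f g :: "nat \<Rightarrow> 'k vec" and x :: nat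
    assume "\<And>y. y < x \<Longrightarrow> f y = g y"
    then have "rhs f x = rhs g x"
      by (auto simp: rhs_def intro!: sum.cong)
    then show "P f x r = P g x r" by (simp add: P_def)
  next
    fix x :: nat and f :: "nat \<Rightarrow> 'k vec"
    show "\<exists>r. P f x r"
    proof (cases "x = 0")
      case True then show ?thesis using v0' by (auto simp: P_def)
    next
      case False
      define M where "M = char_matrix B0 (l + of_nat x)"
      have M: "M \<in> carrier_mat n n" "det M \<noteq> 0"
        using max[of x] False B0 eigenvalue_det[OF B0] by (auto simp: M_def B0_def)
      obtain N where N: "N \<in> carrier_mat n n" "M * N = 1\<^sub>m n"
        using nonzero_det_inverse[OF M] by blast
      have "rhs f x \<in> carrier_vec n" by (simp add: rhs_def)
      then have "M *\<^sub>v (N *\<^sub>v rhs f x) = rhs f x"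
        using M N by (simp flip: assoc_mult_mat_vec[of _ n n _ n])
      then show ?thesis using False N
        by (intro exI[of _ "N *\<^sub>v rhs f x"]) (auto simp: P_def M_def rhs_def)
    qed
  qed
  then obtain v where v: "\<And>j. P v j (v j)" by blast
  have vc: "v j \<in> carrier_vec n" "dim_vec (v j) = n" for j using v[of j] by (auto simp: P_def)
  define V where "V r = Abs_fps (\<lambda>j. v j $ r)" for r
  have eq: "(\<Sum>c<n. fps_nth (B $$ (r, c)) 0 * v j $ c) =
      (l + of_nat j) * v j $ r - (\<Sum>c<n. \<Sum>i=1..j. fps_nth (B $$ (r, c)) i * v (j - i) $ c)"
    if r: "r < n" for r j
  proof (cases "j = 0")
    case True
    then have "v j = v0" using v[of j] by (simp add: P_def)
    then show ?thesis using True arg_cong[OF v0'(2), of "\<lambda>x. x $ r"] v0'(1) r B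
      by (auto simp: scalar_prod_def B0_def atLeast0LessThan)
  next
    case False
    then have "char_matrix B0 (l + of_nat j) *\<^sub>v v j = rhs v j" using v[of j] by (simp add: P_def)
    moreover have "char_matrix B0 (l + of_nat j) *\<^sub>v v j = B0 *\<^sub>v v j - (l + of_nat j) \<cdot>\<^sub>v v j"
      by (rule char_matrix_mult_vec[OF B0 vc(1)])
    ultimately have "(B0 *\<^sub>v v j - (l + of_nat j) \<cdot>\<^sub>v v j) $ r = rhs v j $ r" by simp
    then show ?thesis using r B vc
      by (auto simp: scalar_prod_def B0_def rhs_def atLeast0LessThan algebra_simps)
  qed
  show ?thesis
  proof (rule that[of V])
    fix r assume r: "r < n"
    show "fps_nth (V r) 0 = v0 $ r" using v[of 0] by (simp add: V_def P_def)
    show "(\<Sum>c<n. B $$ (r, c) * V c) = fps_const l * V r + fps_X * fps_deriv (V r)"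
    proof (rule fps_ext)
      fix j
      have "fps_nth (\<Sum>c<n. B $$ (r, c) * V c) j =
          (\<Sum>c<n. \<Sum>i=0..j. fps_nth (B $$ (r, c)) i * v (j - i) $ c)"
        by (simp add: fps_sum_nth fps_mult_nth V_def)
      also have "\<dots> = (\<Sum>c<n. fps_nth (B $$ (r, c)) 0 * v j $ c) +
          (\<Sum>c<n. \<Sum>i=1..j. fps_nth (B $$ (r, c)) i * v (j - i) $ c)"
        by (simp add: sum.atLeast_Suc_atMost sum.distrib)
      also have "\<dots> = (l + of_nat j) * v j $ r" using eq[OF r, of j] by simp
      also have "\<dots> = fps_nth (fps_const l * V r + fps_X * fps_deriv (V r)) j"
        by (cases j) (auto simp: V_def algebra_simps)
      finally show "fps_nth (\<Sum>c<n. B $$ (r, c) * V c) j =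
          fps_nth (fps_const l * V r + fps_X * fps_deriv (V r)) j" .
    qed
  qed
qed

text \<open>
  Supplies the eigenvalue required by the Frobenius recursion: the largest eigenvalue on a ray
  \<open>s + \<nat>\<close>.
\<close>
lemma finite_set_maximal_mod_nat:
  fixes S :: "'k::field_char_0 set"
  assumes "finite S" "S \<noteq> {}"
  obtains x where "x \<in> S" "\<And>j. j \<ge> 1 \<Longrightarrow> x + of_nat j \<notin> S"
proof -
  obtain s where s: "s \<in> S" using assms by auto
  define K where "K = {k. s + of_nat k \<in> S}"
  have "finite K" unfolding K_def
    using finite_vimageI[OF assms(1), of "\<lambda>k. s + of_nat k"] by (simp add: inj_def vimage_def)
  moreover have "0 \<in> K" using s by (simp add: K_def)
  ultimately have k: "Max K \<in> K" "\<And>k. k \<in> K \<Longrightarrow> k \<le> Max K" using Max_in by auto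
  show ?thesis
  proof (rule that[of "s + of_nat (Max K)"])
    show "s + of_nat (Max K) \<in> S" using k by (simp add: K_def)
    fix j :: nat assume "j \<ge> 1"
    then show "s + of_nat (Max K) + of_nat j \<notin> S"
      using k(2)[of "Max K + j"] by (auto simp: K_def add.assoc)
  qed
qed

text \<open>
  Used to bring a nonzero entry of an eigenvector into the first position.
\<close>
lemma gl_equivalent_transposition:
  fixes A :: "'k::field fls mat"
  assumes A: "A \<in> carrier_mat n n" and ab: "a < n" "b < n"
  shows "gl_equivalent n A (mat n n (\<lambda>(r, c). A $$ (Transposition.transpose a b r, Transposition.transpose a b c)))"
proof -
  define t where "t = Transposition.transpose a b"
  have tn: "t r < n \<longleftrightarrow> r < n" for r using ab by (auto simp: t_def Transposition.transpose_def)
  have tt: "t (t r) = r" for r by (simp add: t_def)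
  have sd: "(\<Sum>k = 0..<n. if j = t k then f k else 0) = f (t j)" if "j < n" for j and f :: "nat \<Rightarrow> 'k fls"
  proof -
    have "j = t k \<longleftrightarrow> k = t j" for k using tt by metis
    then show ?thesis using that by (simp add: tn)
  qed
  define P where "P = (mat n n (\<lambda>(r, c). if c = t r then 1 else 0) :: 'k fls mat)"
  define B where "B = mat n n (\<lambda>(r, c). A $$ (t r, t c))"
  have "P * P = 1\<^sub>m n"
    by (intro eq_matI) (auto simp: P_def scalar_prod_def tn tt sd if_distrib[of "\<lambda>x. x * _"] sum.delta cong: if_cong)
  then have "det P * det P = 1" using det_mult[of P n P] by (simp add: P_def)
  then have "det P \<noteq> 0" by auto
  moreover have "B * P = P * A"
    using A by (intro eq_matI) (auto simp: P_def B_def scalar_prod_def tn tt sd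
        if_distrib[of "\<lambda>x. x * _"] if_distrib[of "\<lambda>x. _ * x"] sum.delta cong: if_cong)
  moreover have "map_mat z_deriv P = 0\<^sub>m n n"
    by (intro eq_matI) (auto simp: P_def z_deriv_simps)
  moreover have "P \<in> carrier_mat n n" by (simp add: P_def)
  moreover have "P * A + 0\<^sub>m n n = P * A"
    using A \<open>P \<in> carrier_mat n n\<close> by (intro right_add_zero_mat[of _ n n]) auto
  ultimately show ?thesis unfolding gl_equivalent_def B_def t_def by auto
qed

text \<open>
  The change of basis \<open>h\<close> has \<open>V\<close> as its first column and agrees with the identity elsewhere. As
  \<open>V 0\<close> is a unit among the power series, \<open>h\<close> is invertible over the power series, and the remaining
  block \<open>C\<close> of the transformed connection again has power series entries. This is what keeps the
  induction on the dimension inside the regular connections.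
\<close>
lemma deflation_of_eigenvector:
  fixes B :: "'k::field fps mat" and V :: "nat \<Rightarrow> 'k fps"
  assumes B: "B \<in> carrier_mat (Suc n) (Suc n)" and V0: "fps_nth (V 0) 0 \<noteq> 0"
    and eig: "\<And>r. r < Suc n \<Longrightarrow>
      (\<Sum>c<Suc n. B $$ (r, c) * V c) = fps_const l * V r + fps_X * fps_deriv (V r)"
  obtains W C where "W \<in> carrier_mat 1 n" "C \<in> carrier_mat n n"
    "gl_equivalent (Suc n) (map_mat fps_to_fls B)
      (bordered (fls_const l) W (map_mat fps_to_fls C))"
proof -
  \<comment> \<open>The border \<open>W\<close> and the block \<open>C\<close> are forced by the columns of \<open>B h = h D + z h'\<close> other than the
    first one, on which \<open>h\<close> is constant.\<close>
  define w where "w j = inverse (V 0) * B $$ (0, Suc j)" for j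
  have Vw: "V 0 * w j = B $$ (0, Suc j)" for j
    using inverse_mult_eq_1'[OF V0] by (simp add: w_def flip: mult.assoc)
  define W where "W = mat 1 n (\<lambda>(_, j). fps_to_fls (w j))"
  define C where "C = mat n n (\<lambda>(i, j). B $$ (Suc i, Suc j) - V (Suc i) * w j)"
  define D where "D = bordered (fls_const l) W (map_mat fps_to_fls C)"
  define h where "h = mat (Suc n) (Suc n) (\<lambda>(i, j). if j = 0 then fps_to_fls (V i) else if i = j then 1 else 0)"
  have car: "D \<in> carrier_mat (Suc n) (Suc n)" "h \<in> carrier_mat (Suc n) (Suc n)"
    by (auto simp: D_def h_def W_def C_def)
  have "det h = prod_list (diag_mat h)"
    by (intro det_lower_triangular[of "Suc n"]) (auto simp: h_def)
  also have "\<dots> = fps_to_fls (V 0)"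
    unfolding prod_list_diag_prod by (simp add: h_def prod.atLeast0_lessThan_Suc_shift del: prod.op_ivl_Suc)
  finally have "det h \<noteq> 0" using V0 by auto
  moreover have "map_mat fps_to_fls B * h = h * D + map_mat z_deriv h"
  proof (intro eq_matI)
    fix i j assume "i < dim_row (h * D + map_mat z_deriv h)" "j < dim_col (h * D + map_mat z_deriv h)"
    then have i: "i < Suc n" and j: "j < Suc n" using car by auto
    have L: "(map_mat fps_to_fls B * h) $$ (i, j) = (\<Sum>k<Suc n. fps_to_fls (B $$ (i, k)) * h $$ (k, j))"
      using i j B car by (simp add: scalar_prod_def atLeast0LessThan)
    have R: "(h * D) $$ (i, j) = h $$ (i, 0) * D $$ (0, j) + (\<Sum>k<n. h $$ (i, Suc k) * D $$ (Suc k, j))"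
      using i j car by (simp add: scalar_prod_def atLeast0LessThan sum.lessThan_Suc_shift del: sum.lessThan_Suc)
    show "(map_mat fps_to_fls B * h) $$ (i, j) = (h * D + map_mat z_deriv h) $$ (i, j)"
    proof (cases j)
      case 0
      have "(map_mat fps_to_fls B * h) $$ (i, j) = fps_to_fls (\<Sum>k<Suc n. B $$ (i, k) * V k)"
        unfolding L fps_to_fls_sum by (intro sum.cong) (auto simp: h_def 0 fls_times_fps_to_fls)
      also have "\<dots> = fps_to_fls (V i) * fls_const l + z_deriv (fps_to_fls (V i))"
        unfolding eig[OF i] by (simp add: z_deriv_fps_to_fls fls_times_fps_to_fls mult.commute)
      also have "fps_to_fls (V i) * fls_const l = (h * D) $$ (i, j)"
        unfolding R using i by (simp add: h_def D_def 0 W_def C_def)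
      finally show ?thesis using i j car by (simp add: h_def 0)
    next
      case (Suc j')
      have j': "j' < n" using j Suc by simp
      have "(map_mat fps_to_fls B * h) $$ (i, j) = fps_to_fls (B $$ (i, j))"
        unfolding L using j by (simp add: h_def Suc if_distrib[of "\<lambda>x. _ * x"] cong: if_cong del: sum.lessThan_Suc)
      also have "\<dots> = (h * D) $$ (i, j)"
      proof (cases i)
        case 0
        then show ?thesis unfolding R using j' Vw[of j', symmetric]
          by (simp add: h_def D_def Suc W_def C_def fls_times_fps_to_fls)
      next
        case (Suc i')
        have "(\<Sum>k<n. h $$ (i, Suc k) * D $$ (Suc k, j)) = (\<Sum>k<n. if k = i' then fps_to_fls (C $$ (k, j')) else 0)"
          using i j' by (intro sum.cong) (auto simp: h_def D_def Suc \<open>j = Suc j'\<close> C_def W_def)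
        then show ?thesis unfolding R using i j'
          by (simp add: h_def D_def Suc \<open>j = Suc j'\<close> W_def C_def fls_times_fps_to_fls)
      qed
      finally show ?thesis using i j car by (simp add: h_def Suc z_deriv_simps)
    qed
  qed (use B car in auto)
  ultimately have "gl_equivalent (Suc n) D (map_mat fps_to_fls B)"
    using car unfolding gl_equivalent_def by auto
  then have "gl_equivalent (Suc n) (map_mat fps_to_fls B) D"
    using gl_equivalent_sym[OF car(1)] B by simp
  then show ?thesis by (intro that[of W C]) (auto simp: D_def W_def C_def)
qed

lemma deflation:
  fixes B :: "'k::{alg_closed_field, field_char_0} fps mat"
  assumes B: "B \<in> carrier_mat (Suc n) (Suc n)"
  obtains l W C where "W \<in> carrier_mat 1 n" "C \<in> carrier_mat n n"
    "gl_equivalent (Suc n) (map_mat fps_to_fls B)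
      (bordered (fls_const l) W (map_mat fps_to_fls C))"
proof -
  define B0 where "B0 = map_mat (\<lambda>f. fps_nth f 0) B"
  have B0: "B0 \<in> carrier_mat (Suc n) (Suc n)" using B by (simp add: B0_def)
  have deg: "degree (char_poly B0) = Suc n" "char_poly B0 \<noteq> 0"
    using degree_monic_char_poly[OF B0] by auto
  have ev: "Collect (eigenvalue B0) = {x. poly (char_poly B0) x = 0}"
    using eigenvalue_root_char_poly[OF B0] by auto
  have "finite (Collect (eigenvalue B0))" unfolding ev using deg by (intro poly_roots_finite)
  moreover have "Collect (eigenvalue B0) \<noteq> {}"
    unfolding ev using alg_closed_imp_poly_has_root[of "char_poly B0"] deg by auto
  ultimately obtain l where l: "eigenvalue B0 l" "\<And>j. j \<ge> 1 \<Longrightarrow> \<not> eigenvalue B0 (l + of_nat j)"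
    using finite_set_maximal_mod_nat by (metis mem_Collect_eq)
  obtain v0 where v0: "eigenvector B0 v0 l" using l by (auto simp: eigenvalue_def)
  then obtain p where p: "p < Suc n" "v0 $ p \<noteq> 0"
    using B0 by (auto simp: eigenvector_def) (metis eq_vecI carrier_vecD index_zero_vec)
  obtain V where V: "\<And>r. r < Suc n \<Longrightarrow> fps_nth (V r) 0 = v0 $ r"
    "\<And>r. r < Suc n \<Longrightarrow> (\<Sum>c<Suc n. B $$ (r, c) * V c) = fps_const l * V r + fps_X * fps_deriv (V r)"
    using power_series_eigenvector[OF B v0[unfolded B0_def] l(2)[unfolded B0_def]] by metis
  define t where "t = Transposition.transpose 0 p"
  have tn: "t r < Suc n \<longleftrightarrow> r < Suc n" for r using p by (auto simp: t_def Transposition.transpose_def)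
  define B' where "B' = mat (Suc n) (Suc n) (\<lambda>(r, c). B $$ (t r, t c))"
  have "t permutes {..<Suc n}" unfolding t_def using p by (intro permutes_swap_id) auto
  then have "(\<Sum>c<Suc n. B $$ (t r, t c) * V (t c)) = (\<Sum>c<Suc n. B $$ (t r, c) * V c)" for r
    by (intro sum.permute[symmetric, of t _ "\<lambda>c. B $$ (t r, c) * V c", unfolded o_def])
  then have eig: "(\<Sum>c<Suc n. B' $$ (r, c) * V (t c)) = fps_const l * V (t r) + fps_X * fps_deriv (V (t r))"
    if "r < Suc n" for r
    using that V(2)[of "t r"] tn by (simp add: B'_def del: sum.lessThan_Suc)
  have B': "B' \<in> carrier_mat (Suc n) (Suc n)" by (simp add: B'_def)
  have nz: "fps_nth (V (t 0)) 0 \<noteq> 0" using V(1)[of p] p by (simp add: t_def)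
  obtain W C where WC: "W \<in> carrier_mat 1 n" "C \<in> carrier_mat n n"
    "gl_equivalent (Suc n) (map_mat fps_to_fls B')
      (bordered (fls_const l) W (map_mat fps_to_fls C))"
    using deflation_of_eigenvector[of B' n "\<lambda>r. V (t r)", OF B' nz eig] by blast
  have "mat (Suc n) (Suc n) (\<lambda>(r, c). map_mat fps_to_fls B $$ (t r, t c)) = map_mat fps_to_fls B'"
    using B tn by (intro eq_matI) (auto simp: B'_def)
  then have "gl_equivalent (Suc n) (map_mat fps_to_fls B) (map_mat fps_to_fls B')"
    using gl_equivalent_transposition[of "map_mat fps_to_fls B" "Suc n" 0 p] B p by (simp add: t_def)
  then show ?thesis
    using gl_equivalent_trans[OF _ _ _ _ WC(3)] B B' WC by (intro that[of W C l]) auto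
qed

section \<open>Reduction to a constant triangular matrix\<close>

definition coeff_mat :: "int \<Rightarrow> 'k::zero fls mat \<Rightarrow> 'k mat" where
  "coeff_mat j = map_mat (\<lambda>f. fls_nth f j)"

lemma coeff_mat_carrier [simp]: "coeff_mat j A \<in> carrier_mat nr nc \<longleftrightarrow> A \<in> carrier_mat nr nc"
  by (simp add: coeff_mat_def)

lemma coeff_mat_index [simp]:
  "r < dim_row A \<Longrightarrow> c < dim_col A \<Longrightarrow> coeff_mat j A $$ (r, c) = fls_nth (A $$ (r, c)) j"
  "dim_row (coeff_mat j A) = dim_row A" "dim_col (coeff_mat j A) = dim_col A"
  by (simp_all add: coeff_mat_def)

lemma coeff_mat_eqI:
  assumes "A \<in> carrier_mat nr nc" "B \<in> carrier_mat nr nc" "\<And>j. coeff_mat j A = coeff_mat j B"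
  shows "A = B"
proof (intro eq_matI fls_eqI)
  fix r c j assume "r < dim_row B" "c < dim_col B"
  then show "fls_nth (A $$ (r, c)) j = fls_nth (B $$ (r, c)) j"
    using arg_cong[OF assms(3)[of j], of "\<lambda>M. M $$ (r, c)"] assms(1,2) by simp
qed (use assms(1,2) in auto)

lemma dlog_carrier [simp]: "dlog X \<in> carrier_mat nr nc \<longleftrightarrow> X \<in> carrier_mat nr nc"
  by (simp add: dlog_def)

lemma dlog_index [simp]:
  "r < dim_row X \<Longrightarrow> c < dim_col X \<Longrightarrow> dlog X $$ (r, c) = fls_const (X $$ (r, c))"
  "dim_row (dlog X) = dim_row X" "dim_col (dlog X) = dim_col X"
  by (simp_all add: dlog_def)

lemma coeff_mat_dlog_mult:
  assumes "X \<in> carrier_mat nr n" "A \<in> carrier_mat n nc"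
  shows "coeff_mat j (dlog X * A) = X * coeff_mat j A"
  using assms by (intro eq_matI) (auto simp: scalar_prod_def fls_nth_sum)

lemma coeff_mat_mult_dlog:
  assumes "A \<in> carrier_mat nr n" "X \<in> carrier_mat n nc"
  shows "coeff_mat j (A * dlog X) = coeff_mat j A * X"
  using assms by (intro eq_matI) (auto simp: scalar_prod_def fls_nth_sum)

lemma coeff_mat_add:
  assumes "A \<in> carrier_mat nr nc" "B \<in> carrier_mat nr nc"
  shows "coeff_mat j (A + B) = coeff_mat j A + coeff_mat j B"
  using assms by (intro eq_matI) auto

lemma coeff_mat_z_deriv: "coeff_mat j (map_mat z_deriv A) = of_int j \<cdot>\<^sub>m coeff_mat j A"
  by (intro eq_matI) (auto simp: z_deriv_nth)

lemma coeff_mat_dlog: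
  "coeff_mat j (dlog X) = (if j = 0 then X else 0\<^sub>m (dim_row X) (dim_col X))"
  by (intro eq_matI) auto

text \<open>
  Distinct eigenvalues of a nonresonant triangular matrix never differ by an integer. This is the
  condition under which a border of Laurent series can be made constant.
\<close>
definition nonresonant :: "'k::field mat \<Rightarrow> bool" where
  "nonresonant T \<longleftrightarrow> (\<forall>i<dim_row T. \<forall>j<dim_row T. T $$ (i, i) - T $$ (j, j) \<in> \<int> \<longrightarrow> T $$ (i, i) = T $$ (j, j))"

lemma upper_triangular_smult_one_minus_det:
  fixes T :: "'k::field mat"
  assumes T: "T \<in> carrier_mat n n" "upper_triangular T" and "\<And>i. i < n \<Longrightarrow> a \<noteq> T $$ (i, i)"
  shows "det (a \<cdot>\<^sub>m 1\<^sub>m n - T) \<noteq> 0"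
proof -
  have "det (a \<cdot>\<^sub>m 1\<^sub>m n - T) = prod_list (diag_mat (a \<cdot>\<^sub>m 1\<^sub>m n - T))"
    using T by (intro det_upper_triangular[of _ n]) (auto simp: upper_triangular_def)
  then show ?thesis using assms by (simp add: prod_list_diag_prod)
qed

text \<open>
  A gauge transformation \<open>g\<close> of the lower block is extended by \<open>z\<^sup>d\<close> in the corner, which moves
  \<open>l\<close> to \<open>l + d\<close>. The border becomes another row of Laurent series, which can be made constant
  afterwards.
\<close>
lemma bordered_diagonal_step:
  fixes T :: "'k::field fls mat"
  assumes C: "C \<in> carrier_mat n n" and T: "T \<in> carrier_mat n n" and W: "W \<in> carrier_mat 1 n"
    and "gl_equivalent n C T"
  obtains W' where "W' \<in> carrier_mat 1 n" "gl_equivalent (Suc n) (bordered l W C) (bordered (l + of_int d) W' T)"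
proof -
  obtain g where g: "g \<in> carrier_mat n n" "det g \<noteq> 0" "T * g = g * C + map_mat z_deriv g"
    using assms(4) by (auto simp: gl_equivalent_def)
  obtain h where h: "h \<in> carrier_mat n n" "h * g = 1\<^sub>m n" using nonzero_det_inverse[OF g(1,2)] by blast
  define z where "z = (fls_X_intpow d :: 'k fls)"
  have zd: "z_deriv z = of_int d * z"
    by (intro fls_eqI) (auto simp: z_deriv_nth z_def fls_of_int)
  define W' where "W' = z \<cdot>\<^sub>m (W * h)"
  have W': "W' \<in> carrier_mat 1 n" using W h by (simp add: W'_def)
  define G where "G = bordered z (0\<^sub>m 1 n) g"
  have W'g: "W' * g = z \<cdot>\<^sub>m W" 
    using W g(1) h by (simp add: W'_def mult_smult_assoc_mat[of _ 1 n _ n] assoc_mult_mat[of _ 1 n _ n _ n])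
  have "bordered (l + of_int d) W' T * G = bordered (l * z + of_int d * z) (z \<cdot>\<^sub>m W) (T * g)"
    using W' T g(1) W by (simp add: G_def bordered_mult[of _ n] W'g algebra_simps)
  moreover have "G * bordered l W C = bordered (l * z) (z \<cdot>\<^sub>m W) (g * C)"
    using W C g(1) by (simp add: G_def bordered_mult[of _ n] mult.commute)
  moreover have "map_mat z_deriv G = bordered (of_int d * z) (0\<^sub>m 1 n) (map_mat z_deriv g)"
  proof -
    have "map_mat z_deriv (0\<^sub>m 1 n) = (0\<^sub>m 1 n :: 'k fls mat)"
      by (intro eq_matI) (auto simp: z_deriv_simps)
    then show ?thesis using g(1) by (simp add: G_def map_mat_bordered[of _ n] z_deriv_simps zd)
  qed
  ultimately have "bordered (l + of_int d) W' T * G = G * bordered l W C + map_mat z_deriv G"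
    using W C g(1) by (simp add: bordered_add[of _ n] g(3))
  moreover have "det G \<noteq> 0" using g by (simp add: G_def det_bordered[of _ n] z_def)
  moreover have "G \<in> carrier_mat (Suc n) (Suc n)" using g by (simp add: G_def)
  ultimately show ?thesis using that[OF W'] unfolding gl_equivalent_def by blast
qed

text \<open>
  The transformation \<open>bordered 1 u 1\<close> subtracts \<open>l u - u T - z u'\<close> from the border, so
  \<open>u\<close> has to solve \<open>u\<^sub>j ((l - j) - T) = W\<^sub>j\<close> for every \<open>j \<noteq> 0\<close>. The assumption on \<open>l\<close> makes all these
  triangular systems invertible; only the constant coefficient \<open>W\<^sub>0\<close> of the border survives.
\<close>
lemma bordered_constant_step:
  fixes T :: "'k::field_char_0 mat"
  assumes T: "T \<in> carrier_mat n n" "upper_triangular T" and W: "W \<in> carrier_mat 1 n"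
    and nr: "\<And>i. i < n \<Longrightarrow> l - T $$ (i, i) \<in> \<int> \<Longrightarrow> l = T $$ (i, i)"
  obtains w where "w \<in> carrier_mat 1 n"
    "gl_equivalent (Suc n) (bordered (fls_const l) W (dlog T)) (dlog (bordered l w T))"
proof -
  define M where "M j = (l - of_int j) \<cdot>\<^sub>m 1\<^sub>m n - T" for j
  have M: "M j \<in> carrier_mat n n" for j using T by (auto simp: M_def)
  have "\<exists>N. N \<in> carrier_mat n n \<and> N * M j = 1\<^sub>m n" if "j \<noteq> 0" for j
  proof -
    have "det (M j) \<noteq> 0" unfolding M_def
    proof (rule upper_triangular_smult_one_minus_det[OF T])
      fix i assume i: "i < n"
      show "l - of_int j \<noteq> T $$ (i, i)"
      proof
        assume "l - of_int j = T $$ (i, i)"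
        then have e: "l - T $$ (i, i) = of_int j" by (simp add: algebra_simps)
        then have "l = T $$ (i, i)" using nr[OF i] by simp
        then show False using e that by simp
      qed
    qed
    then show ?thesis using nonzero_det_inverse[OF M] by metis
  qed
  then obtain N where N: "\<And>j. j \<noteq> 0 \<Longrightarrow> N j \<in> carrier_mat n n" "\<And>j. j \<noteq> 0 \<Longrightarrow> N j * M j = 1\<^sub>m n"
    by metis
  define s where "s j = (if j = 0 then 0\<^sub>m 1 n else coeff_mat j W * N j)" for j
  have s: "s j \<in> carrier_mat 1 n" for j using W N by (simp add: s_def)
  \<comment> \<open>A common lower bound for the orders of the entries of \<open>W\<close>; below it the coefficients of \<open>u\<close>
    vanish too, so \<open>u\<close> consists of Laurent series.\<close>
  obtain L where L: "\<And>j c. j < L \<Longrightarrow> c < n \<Longrightarrow> fls_nth (W $$ (0, c)) j = 0"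
  proof
    fix j c assume "j < Min (insert 0 ((\<lambda>c. fls_subdegree (W $$ (0, c))) ` {..<n}))" "c < n"
    then have "j < fls_subdegree (W $$ (0, c))" by simp
    then show "fls_nth (W $$ (0, c)) j = 0" by simp
  qed
  have s0: "s j $$ (0, c) = 0" if "j < L" "c < n" for j c
  proof (cases "j = 0")
    case False
    then have "(coeff_mat j W * N j) $$ (0, c) = (\<Sum>k = 0..<n. fls_nth (W $$ (0, k)) j * N j $$ (k, c))"
      using W N(1)[of j] that by (simp add: scalar_prod_def)
    then show ?thesis using False L[OF that(1)] by (simp add: s_def)
  qed (use that in \<open>simp add: s_def\<close>)
  define u where "u = mat 1 n (\<lambda>(_, c). Abs_fls (\<lambda>j. s j $$ (0, c)))"
  have u: "u \<in> carrier_mat 1 n" by (simp add: u_def)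
  have cu: "coeff_mat j u = s j" for j
  proof (intro eq_matI)
    fix r c assume "r < dim_row (s j)" "c < dim_col (s j)"
    then have "r = 0" "c < n" using s[of j] by auto
    then show "coeff_mat j u $$ (r, c) = s j $$ (r, c)"
      using s0 by (simp add: u_def nth_Abs_fls_lower_bound[of L])
  qed (use u s[of j] in auto)
  define w where "w = coeff_mat 0 W"
  have w: "w \<in> carrier_mat 1 n" using W by (simp add: w_def)
  define G where "G = bordered 1 u (1\<^sub>m n)"
  have key: "fls_const l \<cdot>\<^sub>m u + dlog w = (W + u * dlog T) + map_mat z_deriv u"
  proof (rule coeff_mat_eqI[of _ 1 n])
    fix j
    have e: "coeff_mat j (fls_const l \<cdot>\<^sub>m u + dlog w) = l \<cdot>\<^sub>m s j + coeff_mat j (dlog w)"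
      unfolding cu[symmetric] using u w by (intro eq_matI) auto
    have f: "coeff_mat j (W + u * dlog T + map_mat z_deriv u) = coeff_mat j W + s j * T + of_int j \<cdot>\<^sub>m s j"
      using W u T s[of j] by (simp add: coeff_mat_add[of _ 1 n] assoc_add_mat[of _ 1 n] coeff_mat_z_deriv coeff_mat_mult_dlog[of _ 1 n _ n] cu)
    show "coeff_mat j (fls_const l \<cdot>\<^sub>m u + dlog w) = coeff_mat j (W + u * dlog T + map_mat z_deriv u)"
    proof (cases "j = 0")
      case True
      then show ?thesis unfolding e f using w T W by (simp add: s_def coeff_mat_dlog w_def)
    next
      case False
      have "coeff_mat j W = s j * M j"
        using W False N M by (simp add: s_def assoc_mult_mat[of _ 1 n _ n _ n])
      also have "\<dots> = (l - of_int j) \<cdot>\<^sub>m s j - s j * T"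
        using s[of j] T by (simp add: M_def mult_minus_distrib_mat[of _ 1 n _ n] mult_smult_distrib[of _ 1 n _ n])
      finally show ?thesis unfolding e f using s[of j] T w False
        by (intro eq_matI) (auto simp: coeff_mat_dlog algebra_simps)
    qed
  qed (use W u w T in auto)
  have "dlog (bordered l w T) = bordered (fls_const l) (dlog w) (dlog T)"
    unfolding dlog_def using w T by (simp add: map_mat_bordered[of _ n])
  then have "dlog (bordered l w T) * G = bordered (fls_const l) (fls_const l \<cdot>\<^sub>m u + dlog w) (dlog T)"
    using w T u by (simp add: G_def bordered_mult[of _ n])
  moreover have "1 \<cdot>\<^sub>m W = W" by (intro eq_matI) auto
  then have "G * bordered (fls_const l) W (dlog T) = bordered (fls_const l) (W + u * dlog T) (dlog T)"
    using W T u by (simp add: G_def bordered_mult[of _ n])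
  moreover have "map_mat z_deriv G = bordered 0 (map_mat z_deriv u) (0\<^sub>m n n)"
  proof -
    have "map_mat z_deriv (1\<^sub>m n :: 'k fls mat) = 0\<^sub>m n n"
      by (intro eq_matI) (auto simp: z_deriv_simps)
    then show ?thesis using u by (simp add: G_def map_mat_bordered[of _ n] z_deriv_simps)
  qed
  ultimately have "dlog (bordered l w T) * G = G * bordered (fls_const l) W (dlog T) + map_mat z_deriv G"
    using W T u by (simp add: bordered_add[of _ n] key)
  moreover have "det G \<noteq> 0" using u by (simp add: G_def det_bordered[of _ n])
  moreover have "G \<in> carrier_mat (Suc n) (Suc n)" by (simp add: G_def)
  ultimately show ?thesis using that[OF w] unfolding gl_equivalent_def by blast
qed

theorem power_series_connection_normal_form:
  fixes B :: "'k::{alg_closed_field, field_char_0} fps mat"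
  assumes "B \<in> carrier_mat n n"
  shows "\<exists>T \<in> carrier_mat n n. upper_triangular T \<and> nonresonant T \<and>
    gl_equivalent n (map_mat fps_to_fls B) (dlog T)"
  using assms
proof (induction n arbitrary: B)
  case 0
  have "map_mat fps_to_fls B = dlog (0\<^sub>m 0 0)" using 0 by (intro eq_matI) auto
  moreover have "gl_equivalent 0 (dlog (0\<^sub>m 0 0)) (dlog (0\<^sub>m 0 0 :: 'k mat))"
    unfolding gl_equivalent_def by (intro bexI[of _ "1\<^sub>m 0"]) (auto intro!: eq_matI)
  ultimately show ?case by (intro bexI[of _ "0\<^sub>m 0 0"]) (auto simp: nonresonant_def)
next
  case (Suc n)
  obtain l W C where W: "W \<in> carrier_mat 1 n" and C: "C \<in> carrier_mat n n"
    and eq1: "gl_equivalent (Suc n) (map_mat fps_to_fls B) (bordered (fls_const l) W (map_mat fps_to_fls C))"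
    using deflation[OF Suc.prems] by blast
  obtain T where T: "T \<in> carrier_mat n n" "upper_triangular T" "nonresonant T"
    and CT: "gl_equivalent n (map_mat fps_to_fls C) (dlog T)"
    using Suc.IH[OF C] by blast
  \<comment> \<open>All diagonal entries of \<open>T\<close> in the class of \<open>l\<close> modulo \<open>\<int>\<close> coincide, so one shift moves \<open>l\<close>
    onto all of them.\<close>
  obtain d where d: "\<And>i. i < n \<Longrightarrow> l + of_int d - T $$ (i, i) \<in> \<int> \<Longrightarrow> l + of_int d = T $$ (i, i)"
  proof (cases "\<exists>i<n. l - T $$ (i, i) \<in> \<int>")
    case True
    then obtain i e where i: "i < n" and e: "l - T $$ (i, i) = of_int e" by (auto elim!: Ints_cases)
    then have l: "l + of_int (- e) = T $$ (i, i)" by (simp add: algebra_simps)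
    show ?thesis
      by (rule that[of "- e"], unfold l) (use T i in \<open>auto simp: nonresonant_def\<close>)
  next
    case False
    then show ?thesis by (intro that[of 0]) auto
  qed
  have Cc: "map_mat fps_to_fls C \<in> carrier_mat n n" and Tc: "dlog T \<in> carrier_mat n n"
    using C T by auto
  obtain W' where W': "W' \<in> carrier_mat 1 n" and eq2: "gl_equivalent (Suc n)
      (bordered (fls_const l) W (map_mat fps_to_fls C)) (bordered (fls_const l + of_int d) W' (dlog T))"
    using bordered_diagonal_step[OF Cc Tc W CT] by blast
  have ld: "fls_const l + of_int d = fls_const (l + of_int d)"
    by (intro fls_eqI) (auto simp: fls_of_int)
  obtain w where w: "w \<in> carrier_mat 1 n" and eq3: "gl_equivalent (Suc n)
      (bordered (fls_const l + of_int d) W' (dlog T)) (dlog (bordered (l + of_int d) w T))"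
    unfolding ld using bordered_constant_step[OF T(1,2) W' d] by blast
  define T' where "T' = bordered (l + of_int d) w T"
  have T': "T' \<in> carrier_mat (Suc n) (Suc n)" using T by (simp add: T'_def)
  have "upper_triangular T'"
  proof (rule upper_triangularI)
    fix i j assume ji: "j < i" "i < dim_row T'"
    then have "i - 1 < n" "i < Suc n" "j < Suc n" using T' by auto
    moreover have "T $$ (i - 1, j - 1) = 0" if "j \<noteq> 0"
      using upper_triangularD[OF T(2), of "j - 1" "i - 1"] that ji T(1) T' by simp
    ultimately show "T' $$ (i, j) = 0" using T(1) ji by (simp add: T'_def)
  qed
  moreover have "nonresonant T'"
  proof -
    have diag: "T' $$ (i, i) = (if i = 0 then l + of_int d else T $$ (i - 1, i - 1))" if "i < Suc n" for i
      using that T by (simp add: T'_def)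
    have "T' $$ (i, i) = T' $$ (j, j)"
      if ij: "i < Suc n" "j < Suc n" and z: "T' $$ (i, i) - T' $$ (j, j) \<in> \<int>" for i j
    proof -
      have z': "T' $$ (j, j) - T' $$ (i, i) \<in> \<int>" using Ints_minus[OF z] by simp
      consider "i = 0" "j = 0" | "i = 0" "j \<noteq> 0" | "i \<noteq> 0" "j = 0" | "i \<noteq> 0" "j \<noteq> 0" by blast
      then show ?thesis
      proof cases
        case 2
        then show ?thesis using ij z d[of "j - 1"] by (simp only: diag if_True if_False) simp
      next
        case 3
        then show ?thesis using ij z' d[of "i - 1"] by (simp only: diag if_True if_False) simp
      next
        case 4
        then have "i - 1 < n" "j - 1 < n" using ij by auto
        then show ?thesis using 4 ij z T(1,3) by (simp add: diag nonresonant_def)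
      qed simp
    qed
    then show ?thesis using T' by (simp add: nonresonant_def)
  qed
  moreover have "gl_equivalent (Suc n) (map_mat fps_to_fls B) (dlog T')"
    using gl_equivalent_trans[OF _ _ _ gl_equivalent_trans[OF _ _ _ eq1 eq2] eq3[folded T'_def]]
      Suc.prems C T T' by simp
  ultimately show ?case using T' by blast
qed

section \<open>Pullback and integral shifts of Jordan blocks\<close>

interpretation fls_const: comm_ring_hom fls_const
  by unfold_locales (auto simp: fls_eq_iff)

lemma dlog_mult:
  assumes "A \<in> carrier_mat nr n" "B \<in> carrier_mat n nc"
  shows "dlog (A * B) = dlog A * dlog B"
  unfolding dlog_def using fls_const.mat_hom_mult[OF assms] .

lemma z_deriv_dlog: "map_mat z_deriv (dlog X) = 0\<^sub>m (dim_row X) (dim_col X)"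
  by (intro eq_matI) (auto simp: fls_eq_iff z_deriv_nth)

lemma similar_imp_gl_equivalent_dlog:
  assumes A: "A \<in> carrier_mat n n" and "similar_mat A B"
  shows "gl_equivalent n (dlog A) (dlog B)"
proof -
  obtain P Q where "similar_mat_wit A B P Q" using assms by (auto simp: similar_mat_def)
  note w = similar_mat_witD2[OF A this]
  have "B * Q = Q * A"
    using w assoc_mult_mat[of Q n n "P * B" n Q n] assoc_mult_mat[of Q n n P n B n] by simp
  then have "dlog B * dlog Q = dlog Q * dlog A"
    using dlog_mult[of B n n Q n] dlog_mult[of Q n n A n] w by simp
  moreover have "det P * det Q = 1" using det_mult[of P n Q] w by simp
  then have "det (dlog Q) \<noteq> 0" by (auto simp: dlog_def)
  moreover have "map_mat z_deriv (dlog Q) = 0\<^sub>m n n" using w by (simp add: z_deriv_dlog)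
  moreover have "dlog Q * dlog A + 0\<^sub>m n n = dlog Q * dlog A"
    using w A by (intro right_add_zero_mat[of _ n n]) auto
  ultimately show ?thesis using w unfolding gl_equivalent_def by (intro bexI[of _ "dlog Q"]) auto
qed

lemma pullback_dlog: "m \<ge> 1 \<Longrightarrow> pullback m (dlog X) = dlog (of_nat m \<cdot>\<^sub>m X)"
  by (intro eq_matI) (auto simp: pullback_def fls_of_nat)

lemma gl_equivalent_pullback:
  fixes A B :: "'k::field fls mat"
  assumes A: "A \<in> carrier_mat n n" and B: "B \<in> carrier_mat n n" and m: "m \<ge> 1"
    and "gl_equivalent n A B"
  shows "gl_equivalent n (pullback m A) (pullback m B)"
proof -
  obtain g where g: "g \<in> carrier_mat n n" "det g \<noteq> 0" "B * g = g * A + map_mat z_deriv g"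
    using assms by (auto simp: gl_equivalent_def)
  define c where "c = (\<lambda>f::'k fls. fls_compose_power f m)"
  interpret c: comm_ring_hom c
    using m by unfold_locales (auto simp: c_def)
  have inj: "f = 0" if "c f = 0" for f
  proof (rule fls_eqI)
    fix j
    have "fls_nth (c f) (int m * j) = fls_nth f j"
      using m by (simp add: c_def fls_nth_compose_power)
    then show "fls_nth f j = fls_nth 0 j" using that by simp
  qed
  have dz: "map_mat z_deriv (map_mat c g) = of_nat m \<cdot>\<^sub>m map_mat c (map_mat z_deriv g)"
    by (intro eq_matI) (auto simp: c_def z_deriv_compose_power[OF m])
  have car: "map_mat c g \<in> carrier_mat n n" "map_mat c A \<in> carrier_mat n n"
    "map_mat c B \<in> carrier_mat n n" "map_mat c (map_mat z_deriv g) \<in> carrier_mat n n"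
    using A B g by auto
  have "map_mat c B * map_mat c g = map_mat c (B * g)"
    using c.mat_hom_mult[OF B g(1)] by simp
  also have "\<dots> = map_mat c g * map_mat c A + map_mat c (map_mat z_deriv g)"
  proof -
    have "map_mat c (X + Y) = map_mat c X + map_mat c Y"
      if "X \<in> carrier_mat n n" "Y \<in> carrier_mat n n" for X Y
      using that by (intro eq_matI) (auto simp: c.hom_add)
    then show ?thesis unfolding g(3) using A g(1) c.mat_hom_mult[OF g(1) A] by simp
  qed
  finally have "pullback m B * map_mat c g = map_mat c g * pullback m A + map_mat z_deriv (map_mat c g)"
    unfolding pullback_def c_def[symmetric] dz using car
    by (simp add: mult_smult_distrib[of _ n n _ n] mult_smult_assoc_mat[of _ n n _ n]
        add_smult_distrib_left_mat[of _ n n])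
  moreover have "det (map_mat c g) \<noteq> 0" using inj g(2) by auto
  ultimately show ?thesis using car unfolding gl_equivalent_def by blast
qed

lemma pullback_sl:
  assumes "A \<in> sl n"
  shows "pullback m A \<in> sl n"
proof -
  have A: "A \<in> carrier_mat n n" "mat_trace A = 0" using assms by (auto simp: sl_def)
  have "mat_trace (pullback m A) = of_nat m * fls_compose_power (mat_trace A) m"
    using A(1) by (simp add: mat_trace_def pullback_def fls_compose_power_sum sum_distrib_left)
  then show ?thesis using A by (simp add: sl_def pullback_carrier)
qed

lemma dlog_sl: "X \<in> sl n \<Longrightarrow> dlog X \<in> sl n"
  by (auto simp: sl_def mat_trace_dlog[of _ n])

lemma gl_equivalent_scalar_shift:
  fixes A :: "'k::field fls mat"
  assumes A: "A \<in> carrier_mat n n"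
  shows "gl_equivalent n A (A + of_int d \<cdot>\<^sub>m 1\<^sub>m n)"
proof -
  define z where "z = (fls_X_intpow d :: 'k fls)"
  have zd: "z_deriv z = of_int d * z"
    by (intro fls_eqI) (auto simp: z_deriv_nth z_def fls_of_int)
  define g where "g = z \<cdot>\<^sub>m 1\<^sub>m n"
  have g: "g \<in> carrier_mat n n" "det g \<noteq> 0" by (auto simp: g_def z_def)
  have D: "map_mat z_deriv g = (of_int d * z) \<cdot>\<^sub>m 1\<^sub>m n"
    by (intro eq_matI) (auto simp: g_def zd z_deriv_simps)
  have "(A + of_int d \<cdot>\<^sub>m 1\<^sub>m n) * g = z \<cdot>\<^sub>m (A + of_int d \<cdot>\<^sub>m 1\<^sub>m n)"
    using A by (simp add: g_def mult_smult_distrib[of _ n n _ n])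
  also have "\<dots> = z \<cdot>\<^sub>m A + (of_int d * z) \<cdot>\<^sub>m 1\<^sub>m n"
    using A by (intro eq_matI) (auto simp: algebra_simps)
  also have "z \<cdot>\<^sub>m A = g * A" using A by (simp add: g_def mult_smult_assoc_mat[of _ n n _ n])
  finally show ?thesis using g unfolding gl_equivalent_def D[symmetric] by blast
qed

lemma gl_equivalent_refl:
  fixes A :: "'k::field fls mat"
  assumes A: "A \<in> carrier_mat n n"
  shows "gl_equivalent n A A"
proof -
  have "A + of_int 0 \<cdot>\<^sub>m 1\<^sub>m n = A" using A by (intro eq_matI) auto
  then show ?thesis using gl_equivalent_scalar_shift[OF A, of 0] by simp
qed

lemma gl_equivalent_block_diag:
  fixes A1 A2 B1 B2 :: "'k::field fls mat"
  assumes A: "A1 \<in> carrier_mat n n" "A2 \<in> carrier_mat m m"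
    and B: "B1 \<in> carrier_mat n n" "B2 \<in> carrier_mat m m"
    and e: "gl_equivalent n A1 B1" "gl_equivalent m A2 B2"
  shows "gl_equivalent (n + m) (four_block_mat A1 (0\<^sub>m n m) (0\<^sub>m m n) A2)
    (four_block_mat B1 (0\<^sub>m n m) (0\<^sub>m m n) B2)"
proof -
  obtain g h where g: "g \<in> carrier_mat n n" "det g \<noteq> 0" "B1 * g = g * A1 + map_mat z_deriv g"
    and h: "h \<in> carrier_mat m m" "det h \<noteq> 0" "B2 * h = h * A2 + map_mat z_deriv h"
    using e by (auto simp: gl_equivalent_def)
  define G where "G = four_block_mat g (0\<^sub>m n m) (0\<^sub>m m n) h"
  have mult: "four_block_mat M1 (0\<^sub>m n m) (0\<^sub>m m n) M2 * four_block_mat N1 (0\<^sub>m n m) (0\<^sub>m m n) N2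
      = four_block_mat (M1 * N1) (0\<^sub>m n m) (0\<^sub>m m n) (M2 * N2)"
    if "M1 \<in> carrier_mat n n" "M2 \<in> carrier_mat m m" "N1 \<in> carrier_mat n n" "N2 \<in> carrier_mat m m"
    for M1 M2 N1 N2 :: "'k fls mat"
    using that by (subst mult_four_block_mat[of _ n n _ m _ m]) auto
  have D: "map_mat z_deriv G = four_block_mat (map_mat z_deriv g) (0\<^sub>m n m) (0\<^sub>m m n) (map_mat z_deriv h)"
    using g h by (intro eq_matI) (auto simp: G_def z_deriv_simps)
  have "four_block_mat B1 (0\<^sub>m n m) (0\<^sub>m m n) B2 * G =
      G * four_block_mat A1 (0\<^sub>m n m) (0\<^sub>m m n) A2 + map_mat z_deriv G"
    unfolding D unfolding G_def using A B g h
    by (simp add: mult add_four_block_mat[of _ n n _ m _ m])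
  moreover have "det G \<noteq> 0" using g h
    by (simp add: G_def det_four_block_mat_lower_left_zero[of _ n _ m])
  moreover have "G \<in> carrier_mat (n + m) (n + m)" using g h by (simp add: G_def)
  ultimately show ?thesis unfolding gl_equivalent_def by blast
qed

text \<open>
  After pullback of order \<open>m\<close> the eigenvalue of a block is multiplied by \<open>m\<close>, so a rational shift by
  \<open>d / m\<close> has become an integral one, and \<open>z\<^sup>d\<close> times the identity of the block performs it.
\<close>
lemma gl_equivalent_jordan_shift:
  fixes xs ys :: "(nat \<times> 'k::field) list"
  assumes m: "m \<ge> 1"
    and "list_all2 (\<lambda>x y. fst x = fst y \<and> of_nat m * (snd y - snd x) \<in> \<int>) xs ys"
  shows "gl_equivalent (sum_list (map fst xs)) (pullback m (dlog (jordan_matrix xs)))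
    (pullback m (dlog (jordan_matrix ys)))"
  using assms(2)
proof (induction rule: list_all2_induct)
  case Nil
  then show ?case by (intro gl_equivalent_refl pullback_carrier) auto
next
  case (Cons x xs y ys)
  obtain a u v where x: "x = (a, u)" and y: "y = (a, v)" using Cons by (cases x; cases y) auto
  obtain d where d: "of_nat m * (v - u) = of_int d" using Cons x y by (auto elim: Ints_cases)
  define N where "N = sum_list (map fst xs)"
  have N: "sum_list (map fst ys) = N"
    using Cons(2) unfolding N_def by (induction rule: list_all2_induct) auto
  have J: "jordan_matrix xs \<in> carrier_mat N N" "jordan_matrix ys \<in> carrier_mat N N"
    using jordan_matrix_carrier[of xs] jordan_matrix_carrier[of ys] N by (auto simp: N_def)
  have "pullback m (dlog (jordan_block a v)) = pullback m (dlog (jordan_block a u)) + of_int d \<cdot>\<^sub>m 1\<^sub>m a"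
  proof (intro eq_matI)
    fix i j
    assume "i < dim_row (pullback m (dlog (jordan_block a u)) + of_int d \<cdot>\<^sub>m 1\<^sub>m a)"
      "j < dim_col (pullback m (dlog (jordan_block a u)) + of_int d \<cdot>\<^sub>m 1\<^sub>m a)"
    then have ij: "i < a" "j < a" by auto
    have "of_nat m * v = of_nat m * u + of_int d" using d by (simp add: algebra_simps)
    then have "fls_const (of_nat m * v) = fls_const (of_nat m * u) + of_int d"
      by (simp add: fls_const.hom_add fls_of_int)
    then show "pullback m (dlog (jordan_block a v)) $$ (i, j) =
        (pullback m (dlog (jordan_block a u)) + of_int d \<cdot>\<^sub>m 1\<^sub>m a) $$ (i, j)"
      using ij m by (auto simp: pullback_dlog jordan_block_def)
  qed (auto simp: pullback_def)
  then have blk: "gl_equivalent a (pullback m (dlog (jordan_block a u))) (pullback m (dlog (jordan_block a v)))"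
    using gl_equivalent_scalar_shift[of "pullback m (dlog (jordan_block a u))" a d]
    by (simp add: pullback_carrier)
  have four: "pullback m (dlog (jordan_matrix ((a, w) # zs))) =
      four_block_mat (pullback m (dlog (jordan_block a w))) (0\<^sub>m a N) (0\<^sub>m N a) (pullback m (dlog (jordan_matrix zs)))"
    if "sum_list (map fst zs) = N" for w zs
    using that jordan_matrix_carrier[of zs]
    by (intro eq_matI) (auto simp: jordan_matrix_Cons pullback_def)
  show ?case
    using gl_equivalent_block_diag[OF _ _ _ _ blk Cons.IH[folded N_def]] J
    by (simp add: x y four N N_def[symmetric] pullback_carrier)
qed

lemma mat_trace_jordan_matrix:
  "mat_trace (jordan_matrix bs) = (\<Sum>(a, x) \<leftarrow> bs. of_nat a * (x :: 'k::field))"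
proof (induction bs)
  case (Cons b bs)
  obtain a x where b: "b = (a, x)" by (cases b)
  define N where "N = sum_list (map fst bs)"
  have J: "jordan_matrix bs \<in> carrier_mat N N" using jordan_matrix_carrier[of bs] by (simp add: N_def)
  define M where "M = jordan_matrix (b # bs)"
  have M: "M = four_block_mat (jordan_block a x) (0\<^sub>m a N) (0\<^sub>m N a) (jordan_matrix bs)"
    by (simp add: M_def b jordan_matrix_Cons N_def)
  have "dim_row M = a + N" unfolding M by (simp add: N_def)
  then have "mat_trace M = (\<Sum>i = 0..<a + N. M $$ (i, i))"
    by (simp add: mat_trace_def atLeast0LessThan)
  also have "\<dots> = (\<Sum>i = 0..<a. M $$ (i, i)) + (\<Sum>i = a..<a + N. M $$ (i, i))"
    by (simp add: sum.atLeastLessThan_concat)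
  also have "(\<Sum>i = 0..<a. M $$ (i, i)) = of_nat a * x"
    unfolding M by simp
  also have "(\<Sum>i = a..<a + N. M $$ (i, i)) = (\<Sum>i = 0..<N. M $$ (i + a, i + a))"
    using sum.shift_bounds_nat_ivl[of "\<lambda>i. M $$ (i, i)" 0 a N] by (simp add: add.commute)
  also have "\<dots> = mat_trace (jordan_matrix bs)"
    unfolding M by (simp add: mat_trace_def atLeast0LessThan N_def)
  finally show ?case using Cons by (simp add: M_def b)
qed (simp add: mat_trace_def)

section \<open>Constant connections and Jordan matrices up to similarity\<close>

text \<open>
  The entries of \<open>H\<close> vanish successively, starting in the lower left corner: the relation at position
  \<open>(i, j)\<close> involves \<open>H $$ (i, j)\<close>, with the nonzero factor \<open>B $$ (i, i) - A $$ (j, j) - c\<close>, and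
  otherwise only entries below it or to its left.
\<close>
lemma triangular_intertwiner_zero:
  fixes A B H :: "'k::field mat"
  assumes A: "A \<in> carrier_mat n n" "upper_triangular A" and B: "B \<in> carrier_mat n n" "upper_triangular B"
    and H: "H \<in> carrier_mat n n" and eq: "B * H = H * A + c \<cdot>\<^sub>m H"
    and sep: "\<And>i j. i < n \<Longrightarrow> j < n \<Longrightarrow> B $$ (i, i) \<noteq> A $$ (j, j) + c"
  shows "H = 0\<^sub>m n n"
proof (intro eq_matI)
  have "H $$ (i, j) = 0" if "i < n" "j < n" for i j
    using that
  proof (induction "n - i + j" arbitrary: i j rule: less_induct)
    case less
    have "(B * H) $$ (i, j) = (\<Sum>k = 0..<n. B $$ (i, k) * H $$ (k, j))"
      using B H less by (simp add: scalar_prod_def)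
    also have "\<dots> = (\<Sum>k = 0..<n. if k = i then B $$ (i, i) * H $$ (i, j) else 0)"
    proof (intro sum.cong refl)
      fix k assume k: "k \<in> {0..<n}"
      consider "k < i" | "k = i" | "k > i" by linarith
      then show "B $$ (i, k) * H $$ (k, j) = (if k = i then B $$ (i, i) * H $$ (i, j) else 0)"
      proof cases
        case 1
        then show ?thesis using upper_triangularD[OF B(2) 1] less B by simp
      next
        case 3
        then show ?thesis using less.hyps[of k j] less.prems k by simp
      qed simp
    qed
    also have "\<dots> = B $$ (i, i) * H $$ (i, j)" using less by simp
    finally have L: "(B * H) $$ (i, j) = B $$ (i, i) * H $$ (i, j)" .
    have "(H * A) $$ (i, j) = (\<Sum>k = 0..<n. H $$ (i, k) * A $$ (k, j))"
      using A H less by (simp add: scalar_prod_def)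
    also have "\<dots> = (\<Sum>k = 0..<n. if k = j then H $$ (i, j) * A $$ (j, j) else 0)"
    proof (intro sum.cong refl)
      fix k assume k: "k \<in> {0..<n}"
      consider "k < j" | "k = j" | "k > j" by linarith
      then show "H $$ (i, k) * A $$ (k, j) = (if k = j then H $$ (i, j) * A $$ (j, j) else 0)"
      proof cases
        case 1
        then show ?thesis using less.hyps[of i k] less.prems k by simp
      next
        case 3
        then show ?thesis using upper_triangularD[OF A(2) 3] k A by simp
      qed simp
    qed
    also have "\<dots> = H $$ (i, j) * A $$ (j, j)" using less by simp
    finally have R: "(H * A) $$ (i, j) = H $$ (i, j) * A $$ (j, j)" .
    have "(B * H) $$ (i, j) = (H * A) $$ (i, j) + c * H $$ (i, j)"
      unfolding eq using H A less by simp
    then have "(B $$ (i, i) - (A $$ (j, j) + c)) * H $$ (i, j) = 0"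
      unfolding L R by (simp add: algebra_simps)
    then show ?case using sep[OF less.prems] by simp
  qed
  then show "H $$ (i, j) = 0\<^sub>m n n $$ (i, j)" if "i < dim_row (0\<^sub>m n n)" "j < dim_col (0\<^sub>m n n)" for i j
    using that by simp
qed (use H in auto)

text \<open>
  The coefficient of \<open>z\<^sup>j\<close> of a gauge transformation intertwines \<open>A + j\<close> and \<open>B\<close>. Unless \<open>j = 0\<close>
  these have no common eigenvalue, so the transformation is constant.
\<close>
lemma gl_equivalent_constant_imp_similar:
  fixes A B :: "'k::field_char_0 mat"
  assumes A: "A \<in> carrier_mat n n" "upper_triangular A" and B: "B \<in> carrier_mat n n" "upper_triangular B"
    and sep: "\<And>i j. i < n \<Longrightarrow> j < n \<Longrightarrow> B $$ (i, i) - A $$ (j, j) \<in> \<int> \<Longrightarrow> B $$ (i, i) = A $$ (j, j)"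
    and "gl_equivalent n (dlog A) (dlog B)"
  shows "similar_mat B A"
proof -
  obtain g where g: "g \<in> carrier_mat n n" "det g \<noteq> 0" "dlog B * g = g * dlog A + map_mat z_deriv g"
    using assms(6) by (auto simp: gl_equivalent_def)
  have eq: "B * coeff_mat j g = coeff_mat j g * A + of_int j \<cdot>\<^sub>m coeff_mat j g" for j
    using arg_cong[OF g(3), of "coeff_mat j"] A(1) B(1) g(1)
    by (simp add: coeff_mat_dlog_mult[of _ n n _ n] coeff_mat_mult_dlog[of _ n n _ n]
        coeff_mat_add[of _ n n] coeff_mat_z_deriv)
  have z: "coeff_mat j g = 0\<^sub>m n n" if "j \<noteq> 0" for j
  proof (rule triangular_intertwiner_zero[OF A B _ eq])
    fix p q assume pq: "p < n" "q < n"
    show "B $$ (p, p) \<noteq> A $$ (q, q) + of_int j"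
    proof
      assume e: "B $$ (p, p) = A $$ (q, q) + of_int j"
      then have "B $$ (p, p) - A $$ (q, q) = of_int j" by simp
      then have "B $$ (p, p) = A $$ (q, q)" using sep[OF pq] by simp
      then show False using e that by simp
    qed
  qed (use g in simp)
  define Q where "Q = coeff_mat 0 g"
  have Q: "Q \<in> carrier_mat n n" using g by (simp add: Q_def)
  have "g = dlog Q"
  proof (rule coeff_mat_eqI[of _ n n])
    fix j show "coeff_mat j g = coeff_mat j (dlog Q)"
      using z[of j] Q by (cases "j = 0") (auto simp: coeff_mat_dlog Q_def)
  qed (use g Q in auto)
  then have "det Q \<noteq> 0" using g(2) by (auto simp: dlog_def)
  then obtain P where P: "P \<in> carrier_mat n n" "P * Q = 1\<^sub>m n" "Q * P = 1\<^sub>m n"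
    using nonzero_det_inverse[OF Q] by blast
  have BQ: "B * Q = Q * A"
  proof -
    have "Q * A + 0 \<cdot>\<^sub>m Q = Q * A" using A(1) Q by (intro eq_matI) auto
    then show ?thesis using eq[of 0] by (simp add: Q_def)
  qed
  have "B = B * (Q * P)" using B P by simp
  also have "\<dots> = Q * A * P" using assoc_mult_mat[OF B(1) Q P(1)] by (simp add: BQ)
  finally have "similar_mat_wit B A Q P" using A B P Q by (intro similar_mat_witI[of _ _ n]) auto
  then show ?thesis by (auto simp: similar_mat_def)
qed

lemma similar_mat_block_swap:
  fixes A B :: "'k::field mat"
  assumes A: "A \<in> carrier_mat n n" and B: "B \<in> carrier_mat m m"
  shows "similar_mat (four_block_mat A (0\<^sub>m n m) (0\<^sub>m m n) B) (four_block_mat B (0\<^sub>m m n) (0\<^sub>m n m) A)"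
proof -
  define P where "P = four_block_mat (0\<^sub>m n m) (1\<^sub>m n) (1\<^sub>m m) (0\<^sub>m m n :: 'k mat)"
  define Q where "Q = four_block_mat (0\<^sub>m m n) (1\<^sub>m m) (1\<^sub>m n) (0\<^sub>m n m :: 'k mat)"
  let ?X = "four_block_mat A (0\<^sub>m n m) (0\<^sub>m m n) B" and ?Y = "four_block_mat B (0\<^sub>m m n) (0\<^sub>m n m) A"
  have one: "four_block_mat (1\<^sub>m p) (0\<^sub>m p q) (0\<^sub>m q p) (1\<^sub>m q) = (1\<^sub>m (p + q) :: 'k mat)" for p q
    by (intro eq_matI) auto
  have PQ: "P * Q = 1\<^sub>m (n + m)"
    unfolding P_def Q_def by (subst mult_four_block_mat[of _ n m _ n _ m]) (auto simp: one)
  have QP: "Q * P = 1\<^sub>m (n + m)"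
    unfolding P_def Q_def
    by (subst mult_four_block_mat[of _ m n _ m _ n]) (auto simp: one add.commute[of m n])
  have "P * ?Y = four_block_mat (0\<^sub>m n m) A B (0\<^sub>m m n)"
    unfolding P_def using A B by (subst mult_four_block_mat[of _ n m _ n _ m]) auto
  then have "?X = P * ?Y * Q"
    unfolding Q_def using A B by (simp, subst mult_four_block_mat[of _ n m _ n _ m]) auto
  then have "similar_mat_wit ?X ?Y P Q"
    by (rule similar_mat_witI[OF PQ QP]) (use A B in \<open>auto simp: P_def Q_def\<close>)
  then show ?thesis by (auto simp: similar_mat_def)
qed

text \<open>
  Rotating a list of blocks is a swap of two diagonal blocks of the matrix. A rotation brings the
  first block of \<open>xs\<close> to the front of \<open>ys\<close>, and the other blocks are permuted by induction.
\<close>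
lemma similar_mat_jordan_matrix_permute:
  fixes xs ys :: "(nat \<times> 'k::field) list"
  assumes "mset xs = mset ys"
  shows "similar_mat (jordan_matrix xs) (jordan_matrix ys)"
  using assms
proof (induction xs arbitrary: ys)
  case Nil
  then show ?case using similar_mat_refl[OF jordan_matrix_carrier[of "[]"]] by simp
next
  case (Cons x xs)
  obtain a l where x: "x = (a, l)" by (cases x)
  have app: "jordan_matrix (us @ vs) = four_block_mat (jordan_matrix us)
      (0\<^sub>m (sum_list (map fst us)) (sum_list (map fst vs))) (0\<^sub>m (sum_list (map fst vs)) (sum_list (map fst us)))
      (jordan_matrix vs)" for us vs :: "(nat \<times> 'k) list"
    by (simp add: jordan_matrix_def diag_block_mat_append Let_def) (simp flip: jordan_matrix_def)
  have "x \<in> set ys" using Cons.prems by (metis list.set_intros(1) mset_eq_setD)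
  then obtain us vs where ys: "ys = us @ x # vs" by (meson split_list)
  then have ms: "mset xs = mset (vs @ us)" using Cons.prems by simp
  then have len: "sum_list (map fst xs) = sum_list (map fst (vs @ us))"
    by (metis mset_map sum_mset_sum_list)
  have "similar_mat (jordan_matrix (x # xs)) (jordan_matrix (x # (vs @ us)))"
    unfolding x jordan_matrix_Cons len
    by (rule similar_mat_four_block_0_0[OF similar_mat_refl[OF jordan_block_carrier] Cons.IH[OF ms]])
      (use jordan_matrix_carrier[of xs] in \<open>simp_all add: len\<close>)
  moreover have "similar_mat (jordan_matrix ((x # vs) @ us)) (jordan_matrix (us @ (x # vs)))"
    unfolding app by (rule similar_mat_block_swap[OF jordan_matrix_carrier jordan_matrix_carrier])
  ultimately show ?case unfolding ys using similar_mat_trans by fastforce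
qed

lemma jordan_matrix_diag_mem:
  "i < sum_list (map fst bs) \<Longrightarrow> jordan_matrix bs $$ (i, i) \<in> snd ` set bs"
proof (induction bs arbitrary: i)
  case (Cons b bs)
  obtain a l where b: "b = (a, l)" by (cases b)
  have J: "jordan_matrix bs \<in> carrier_mat (sum_list (map fst bs)) (sum_list (map fst bs))"
    by (rule jordan_matrix_carrier)
  show ?case using Cons.IH[of "i - a"] Cons.prems carrier_matD[OF J] by (auto simp: b jordan_matrix_Cons)
qed simp

text \<open>
  The number of blocks of given size and eigenvalue is a combination of the dimensions of
  generalised eigenspaces, hence an invariant of the matrix.
\<close>
lemma jordan_nf_unique_mset:
  fixes A :: "'k::field mat"
  assumes "jordan_nf A xs" "jordan_nf A ys"
  shows "mset xs = mset ys"
proof (rule multiset_eqI)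
  fix b :: "nat \<times> 'k"
  obtain a l where b: "b = (a, l)" by (cases b)
  show "count (mset xs) b = count (mset ys) b"
  proof (cases "a = 0")
    case True
    then have "b \<notin> set xs" "b \<notin> set ys" using assms b by (force simp: jordan_nf_def)+
    then have "count (mset xs) b = 0" "count (mset ys) b = 0" by simp_all
    then show ?thesis by (simp only:)
  next
    case False
    then show ?thesis
      using compute_nr_of_jordan_blocks[OF assms(1) False, of l]
        compute_nr_of_jordan_blocks[OF assms(2) False, of l]
      by (simp only: b count_mset count_list_eq_length_filter)
  qed
qed

lemma common_denominator:
  fixes S :: "'k::field_char_0 set"
  assumes "finite S" "S \<subseteq> \<rat>"
  shows "\<exists>m\<ge>1. \<forall>x\<in>S. of_nat m * x \<in> \<int>"
  using assms
proof (induction S rule: finite_induct)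
  case (insert x S)
  then obtain m where m: "m \<ge> 1" "\<forall>x\<in>S. of_nat m * x \<in> \<int>" by auto
  have "x \<in> \<rat>" using insert by simp
  then obtain p q where q: "q > 0" and x: "x = of_int p / of_int q" by (elim Rats_cases')
  have e: "of_nat (nat q) = (of_int q :: 'k)" using q by (metis of_nat_nat less_imp_le)
  show ?case
  proof (intro exI[of _ "nat q * m"] conjI ballI)
    show "nat q * m \<ge> 1" using q m(1) by simp
    fix y assume y: "y \<in> insert x S"
    show "of_nat (nat q * m) * y \<in> \<int>"
    proof (cases "y = x")
      case True
      have "of_nat (nat q * m) * y = (of_nat m * of_int p :: 'k)"
        using q by (simp add: True x e)
      then show ?thesis by (metis Ints_mult Ints_of_nat Ints_of_int)
    next
      case False
      then have "of_nat m * y \<in> \<int>" using m y by auto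
      then have "of_nat (nat q) * (of_nat m * y) \<in> \<int>" by (rule Ints_mult[OF Ints_of_nat])
      moreover have "of_nat (nat q * m) * y = of_nat (nat q) * (of_nat m * y)" by (simp add: mult.assoc)
      ultimately show ?thesis by (simp only:)
    qed
  qed
qed (auto intro: exI[of _ 1])

section \<open>Regular connections and relationship\<close>

lemma jordan_blocks_of_carrier:
  assumes "jordan_blocks_of X bs" "X \<in> carrier_mat n n"
  shows "sum_list (map fst bs) = n" "X = jordan_matrix bs" "0 \<notin> fst ` set bs"
proof -
  show X: "X = jordan_matrix bs" and "0 \<notin> fst ` set bs"
    using assms by (force simp: jordan_blocks_of_def)+
  show "sum_list (map fst bs) = n"
    using carrier_matD(1)[OF assms(2)] carrier_matD(1)[OF jordan_matrix_carrier[of bs]] by (simp add: X)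
qed

lemma relatedI_gl_pullback:
  fixes A B :: "'k::{alg_closed_field, field_char_0} fls mat"
  assumes "n \<ge> 1" "m \<ge> 1" "A \<in> sl n" "B \<in> sl n" "gl_equivalent n (pullback m A) (pullback m B)"
  shows "related n A B"
  unfolding related_def using assms
  by (intro exI[of _ m] conjI gl_equivalent_imp_gauge_equivalent pullback_sl)

theorem regular_related_to_jordan:
  fixes A :: "'k::{alg_closed_field, field_char_0} fls mat"
  assumes n: "n \<ge> 1" and "A \<in> regular_connections n"
  obtains X where "X \<in> jordan_sl n" "related n A (dlog X)"
proof -
  obtain B where A: "A \<in> sl n" and B: "B \<in> sl_power_series n" "gauge_equivalent n A B"
    using assms(2) by (auto simp: regular_connections_def)
  have Ac: "A \<in> carrier_mat n n" "mat_trace A = 0" using A by (auto simp: sl_def)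
  have Bc: "B \<in> carrier_mat n n" using B by (auto simp: sl_power_series_def sl_def)
  define B' where "B' = map_mat fls_regpart B"
  have B'c: "B' \<in> carrier_mat n n" using Bc by (simp add: B'_def)
  have "map_mat fps_to_fls B' = B"
  proof (intro eq_matI)
    fix i j assume ij: "i < dim_row B" "j < dim_col B"
    then obtain f where "B $$ (i, j) = fps_to_fls f"
      using B Bc by (auto simp: sl_power_series_def)
    then show "map_mat fps_to_fls B' $$ (i, j) = B $$ (i, j)" using ij by (simp add: B'_def)
  qed (auto simp: B'_def)
  then obtain T where T: "T \<in> carrier_mat n n" "upper_triangular T" and BT: "gl_equivalent n B (dlog T)"
    using power_series_connection_normal_form[OF B'c] by auto
  define bs where "bs = triangular_to_jnf_vector T"
  have jnf: "similar_mat T (jordan_matrix bs)" "0 \<notin> fst ` set bs"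
    using triangular_to_jnf_vector[OF T] by (auto simp: jordan_nf_def bs_def)
  define J where "J = jordan_matrix bs"
  have J: "J \<in> carrier_mat n n"
    using similar_matD[OF jnf(1)] T(1) by (auto simp: J_def)
  have N: "sum_list (map fst bs) = n"
    using carrier_matD(1)[OF J] carrier_matD(1)[OF jordan_matrix_carrier[of bs]] by (simp add: J_def)
  have dc: "dlog T \<in> carrier_mat n n" "dlog J \<in> carrier_mat n n" using T J by auto
  have "gl_equivalent n (dlog T) (dlog J)"
    using similar_imp_gl_equivalent_dlog[OF T(1) jnf(1)] by (simp add: J_def)
  then have AJ: "gl_equivalent n A (dlog J)"
    using gl_equivalent_trans[OF Ac(1) Bc dc(2) gauge_equivalent_imp_gl[OF Ac(1) B(2)]
        gl_equivalent_trans[OF Bc dc BT]] by blast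
  \<comment> \<open>\<open>A\<close> is trace-free, so the trace of \<open>J\<close> is the logarithmic derivative of a determinant.\<close>
  obtain N where N': "mat_trace J = of_int N"
  proof -
    obtain g where g: "g \<in> carrier_mat n n" "det g \<noteq> 0" "dlog J * g = g * A + map_mat z_deriv g"
      using AJ by (auto simp: gl_equivalent_def)
    have "z_deriv (det g) = fls_const (mat_trace J) * det g"
      using z_deriv_det_intertwiner[OF Ac(1) dc(2) g(1,3)] Ac(2) J by (simp add: mat_trace_dlog[of _ n])
    then show ?thesis using z_deriv_eq_scale_imp_monomial[OF _ g(2)] that by metis
  qed
  \<comment> \<open>Subtracting \<open>c\<close> from all eigenvalues makes the trace zero; the pullback of order \<open>n\<close> turns \<open>c\<close>
    into the integer \<open>N\<close>.\<close>
  define c where "c = mat_trace J / of_nat n"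
  define bs' where "bs' = map (\<lambda>(a, x). (a, x - c)) bs"
  define X where "X = jordan_matrix bs'"
  have fst_bs': "map fst bs' = map fst bs" by (auto simp: bs'_def)
  have Xc: "X \<in> carrier_mat n n"
    using jordan_matrix_carrier[of bs'] N by (simp add: X_def fst_bs')
  have "(\<Sum>(a, x) \<leftarrow> bs'. of_nat a * x) = (\<Sum>(a, x) \<leftarrow> bs. of_nat a * x) - of_nat (sum_list (map fst bs)) * c"
    unfolding bs'_def by (induction bs) (auto simp: algebra_simps)
  then have "mat_trace X = mat_trace J - of_nat n * c"
    by (simp add: X_def J_def mat_trace_jordan_matrix N)
  then have X0: "mat_trace X = 0" using n by (simp add: c_def)
  have "jordan_blocks_of X bs'"
    using jnf(2) by (force simp: jordan_blocks_of_def X_def bs'_def)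
  then have X: "X \<in> jordan_sl n"
    using Xc X0 by (auto simp: jordan_sl_def jordan_normal_forms_def sl_def)
  have la: "list_all2 (\<lambda>x y. fst x = fst y \<and> of_nat n * (snd y - snd x) \<in> \<int>) bs bs'"
    using n by (auto simp: bs'_def list_all2_map2 c_def N' intro!: list.rel_refl)
  have "gl_equivalent n (pullback n (dlog J)) (pullback n (dlog X))"
    using gl_equivalent_jordan_shift[OF n la] by (simp only: J_def X_def N)
  moreover have "gl_equivalent n (pullback n A) (pullback n (dlog J))"
    by (rule gl_equivalent_pullback[OF Ac(1) dc(2) n AJ])
  ultimately have "gl_equivalent n (pullback n A) (pullback n (dlog X))"
    using gl_equivalent_trans[of "pullback n A" n "pullback n (dlog J)" "pullback n (dlog X)"] Ac dc Xc
    by (simp add: pullback_carrier)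
  then have "related n A (dlog X)"
    using relatedI_gl_pullback[OF n n A dlog_sl] X by (auto simp: jordan_sl_def)
  with X that show ?thesis by blast
qed

lemma differ_rationally_imp_related:
  fixes X Y :: "'k::{alg_closed_field, field_char_0} mat"
  assumes n: "n \<ge> 1" and X: "X \<in> jordan_sl n" and Y: "Y \<in> jordan_sl n"
    and "differ_rationally_after_block_permutation X Y"
  shows "related n (dlog X) (dlog Y)"
proof -
  obtain xs ys t where xs: "jordan_blocks_of X xs" and ys: "jordan_blocks_of Y ys"
    and len: "length xs = length ys" and t: "t permutes {..<length ys}"
    and d: "\<And>i. i < length xs \<Longrightarrow> fst (xs ! i) = fst (ys ! t i) \<and> snd (xs ! i) - snd (ys ! t i) \<in> \<rat>"
    using assms(4) by (auto simp: differ_rationally_after_block_permutation_def)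
  have c: "X \<in> carrier_mat n n" "Y \<in> carrier_mat n n" using X Y by (auto simp: jordan_sl_def sl_def)
  note xs' = jordan_blocks_of_carrier[OF xs c(1)] and ys' = jordan_blocks_of_carrier[OF ys c(2)]
  define zs where "zs = permute_list t ys"
  have zn: "length zs = length xs" "\<And>i. i < length xs \<Longrightarrow> zs ! i = ys ! t i"
    using len t by (auto simp: zs_def permute_list_nth)
  define S where "S = (\<lambda>i. snd (zs ! i) - snd (xs ! i)) ` {..<length xs}"
  have "S \<subseteq> \<rat>"
  proof
    fix q assume "q \<in> S"
    then obtain i where "i < length xs" "q = - (snd (xs ! i) - snd (ys ! t i))" by (auto simp: S_def zn)
    then show "q \<in> \<rat>" using d[of i] Rats_minus_iff by metis
  qed
  then obtain m where m: "m \<ge> 1" "\<And>q. q \<in> S \<Longrightarrow> of_nat m * q \<in> \<int>"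
    using common_denominator[of S] by (auto simp: S_def)
  have la: "list_all2 (\<lambda>x y. fst x = fst y \<and> of_nat m * (snd y - snd x) \<in> \<int>) xs zs"
    unfolding list_all2_conv_all_nth using d m(2) zn by (auto simp: S_def)
  have "gl_equivalent n (pullback m (dlog X)) (pullback m (dlog (jordan_matrix zs)))"
    using gl_equivalent_jordan_shift[OF m(1) la] by (simp only: xs')
  moreover have ms: "mset zs = mset ys" using t by (simp add: zs_def)
  then have sim: "similar_mat (jordan_matrix zs) Y"
    using similar_mat_jordan_matrix_permute ys' by metis
  have zc: "jordan_matrix zs \<in> carrier_mat n n" using similar_matD[OF sim] c by auto
  then have "gl_equivalent n (pullback m (dlog (jordan_matrix zs))) (pullback m (dlog Y))"
    using gl_equivalent_pullback[OF _ _ m(1) similar_imp_gl_equivalent_dlog[OF zc sim]] c by simp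
  ultimately have "gl_equivalent n (pullback m (dlog X)) (pullback m (dlog Y))"
    using gl_equivalent_trans[of "pullback m (dlog X)" n "pullback m (dlog (jordan_matrix zs))" "pullback m (dlog Y)"]
      c zc by (simp add: pullback_carrier)
  then show ?thesis
    using relatedI_gl_pullback[OF n m(1) dlog_sl dlog_sl] X Y by (auto simp: jordan_sl_def)
qed

lemma similar_mat_smult_cancel:
  fixes A B :: "'k::field mat"
  assumes A: "A \<in> carrier_mat n n" and B: "B \<in> carrier_mat n n"
    and c: "c \<noteq> 0" and "similar_mat (c \<cdot>\<^sub>m A) (c \<cdot>\<^sub>m B)"
  shows "similar_mat A B"
proof -
  have cA: "c \<cdot>\<^sub>m A \<in> carrier_mat n n" using A by simp
  obtain P Q where "similar_mat_wit (c \<cdot>\<^sub>m A) (c \<cdot>\<^sub>m B) P Q"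
    using assms(4) by (auto simp: similar_mat_def)
  note w = similar_mat_witD2[OF cA this]
  have "A = inverse c \<cdot>\<^sub>m (c \<cdot>\<^sub>m A)" using c by (intro eq_matI) auto
  also have "\<dots> = inverse c \<cdot>\<^sub>m (c \<cdot>\<^sub>m (P * B * Q))"
    unfolding w(3) using w(6,7) B
    by (simp add: mult_smult_distrib[of _ n n _ n] mult_smult_assoc_mat[of _ n n _ n])
  also have "\<dots> = P * B * Q"
    using c w(6,7) by (intro eq_matI) auto
  finally have "A = P * B * Q" .
  then have "similar_mat_wit A B P Q" using w A B by (intro similar_mat_witI) auto
  then show ?thesis by (auto simp: similar_mat_def)
qed

definition rational_class_rep :: "'k::field_char_0 \<Rightarrow> 'k" where
  "rational_class_rep x = (SOME y. y - x \<in> \<rat>)"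

lemma rational_class_rep_diff: "rational_class_rep x - x \<in> \<rat>"
  unfolding rational_class_rep_def by (rule someI[of _ x]) simp

lemma rational_class_rep_eq_iff: "rational_class_rep x = rational_class_rep y \<longleftrightarrow> x - y \<in> \<rat>"
proof
  assume "rational_class_rep x = rational_class_rep y"
  then have "(rational_class_rep y - y) - (rational_class_rep x - x) = x - y" by simp
  then show "x - y \<in> \<rat>" using Rats_diff[OF rational_class_rep_diff rational_class_rep_diff] by metis
next
  assume q: "x - y \<in> \<rat>"
  have "z - x \<in> \<rat> \<longleftrightarrow> z - y \<in> \<rat>" for z
    using Rats_add[OF _ q, of "z - x"] Rats_diff[OF _ q, of "z - y"] by auto
  then show "rational_class_rep x = rational_class_rep y" by (simp add: rational_class_rep_def)
qed

lemma rational_class_rep_idem: "rational_class_rep (rational_class_rep x) = rational_class_rep x"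
  by (simp add: rational_class_rep_eq_iff rational_class_rep_diff)

text \<open>
  One pullback order \<open>m\<close> serves two purposes: it is a multiple of an order at which the connections
  become gauge equivalent, and of a common denominator of the shifts that move the eigenvalues to the
  representatives of their classes modulo \<open>\<rat>\<close>.
\<close>
lemma related_imp_differ_rationally:
  fixes X Y :: "'k::{alg_closed_field, field_char_0} mat"
  assumes X: "X \<in> jordan_sl n" and Y: "Y \<in> jordan_sl n" and "related n (dlog X) (dlog Y)"
  shows "differ_rationally_after_block_permutation X Y"
proof -
  obtain xs ys where xs: "jordan_blocks_of X xs" and ys: "jordan_blocks_of Y ys"
    using X Y by (auto simp: jordan_sl_def jordan_normal_forms_def)
  have c: "X \<in> carrier_mat n n" "Y \<in> carrier_mat n n" using X Y by (auto simp: jordan_sl_def sl_def)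
  note xs' = jordan_blocks_of_carrier[OF xs c(1)] and ys' = jordan_blocks_of_carrier[OF ys c(2)]
  obtain m0 where m0: "m0 \<ge> 1" "gauge_equivalent n (pullback m0 (dlog X)) (pullback m0 (dlog Y))"
    using assms(3) by (auto simp: related_def)
  define r where "r = (rational_class_rep :: 'k \<Rightarrow> 'k)"
  define R where "R bs = map (\<lambda>b. (fst b, r (snd b))) bs" for bs :: "(nat \<times> 'k) list"
  define S where "S = (\<lambda>b. r (snd b) - snd b) ` (set xs \<union> set ys)"
  have "S \<subseteq> \<rat>" by (auto simp: S_def r_def rational_class_rep_diff)
  then obtain m1 where m1: "m1 \<ge> 1" "\<And>q. q \<in> S \<Longrightarrow> of_nat m1 * q \<in> \<int>"
    using common_denominator[of S] by (auto simp: S_def)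
  define m where "m = m1 * m0"
  have m: "m \<ge> 1" using m0 m1 by (simp add: m_def)
  have int: "of_nat m * q \<in> \<int>" if "q \<in> S" for q
  proof -
    have "of_nat m * q = of_nat m0 * (of_nat m1 * q)" by (simp add: m_def)
    then show ?thesis using m1(2)[OF that] by (metis Ints_mult Ints_of_nat)
  qed
  have la: "list_all2 (\<lambda>x y. fst x = fst y \<and> of_nat m * (snd y - snd x) \<in> \<int>) bs (R bs)"
    if "set bs \<subseteq> set xs \<union> set ys" for bs
    unfolding list_all2_conv_all_nth using that by (auto simp: R_def S_def intro!: int imageI dest: nth_mem)
  have fR: "map fst (R bs) = map fst bs" for bs by (simp add: R_def)
  define X' where "X' = jordan_matrix (R xs)"
  define Y' where "Y' = jordan_matrix (R ys)"
  have X': "X' \<in> carrier_mat n n" using jordan_matrix_carrier[of "R xs"] xs' by (simp add: X'_def fR)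
  have Y': "Y' \<in> carrier_mat n n" using jordan_matrix_carrier[of "R ys"] ys' by (simp add: Y'_def fR)
  have pc: "pullback m (dlog M) \<in> carrier_mat n n" if "M \<in> carrier_mat n n" for M :: "'k mat"
    using that by (simp add: pullback_carrier)
  have XX': "gl_equivalent n (pullback m (dlog X)) (pullback m (dlog X'))"
    using gl_equivalent_jordan_shift[OF m la[of xs]] by (simp add: X'_def xs')
  have YY': "gl_equivalent n (pullback m (dlog Y)) (pullback m (dlog Y'))"
    using gl_equivalent_jordan_shift[OF m la[of ys]] by (simp add: Y'_def ys')
  have "gauge_equivalent n (pullback m1 (pullback m0 (dlog X))) (pullback m1 (pullback m0 (dlog Y)))"
    by (rule pullback_gauge[OF _ m1(1) m0(2)]) (use c in \<open>simp add: pullback_carrier\<close>)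
  then have "gauge_equivalent n (pullback m (dlog X)) (pullback m (dlog Y))"
    using m0(1) m1(1) by (simp add: pullback_pullback m_def)
  then have XY: "gl_equivalent n (pullback m (dlog X)) (pullback m (dlog Y))"
    by (rule gauge_equivalent_imp_gl[OF pc[OF c(1)]])
  have "gl_equivalent n (pullback m (dlog X')) (pullback m (dlog Y'))"
    by (rule gl_equivalent_trans[OF pc[OF X'] pc[OF c(1)] pc[OF Y'] gl_equivalent_sym[OF pc[OF c(1)] pc[OF X'] XX']
          gl_equivalent_trans[OF pc[OF c(1)] pc[OF c(2)] pc[OF Y'] XY YY']])
  then have gl: "gl_equivalent n (dlog (of_nat m \<cdot>\<^sub>m X')) (dlog (of_nat m \<cdot>\<^sub>m Y'))"
    by (simp only: pullback_dlog[OF m])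
  have ut: "upper_triangular (of_nat m \<cdot>\<^sub>m jordan_matrix bs)" for bs :: "(nat \<times> 'k) list"
    by (auto simp: upper_triangular_def jordan_matrix_upper_triangular)
  \<comment> \<open>The diagonal entries of \<open>X'\<close> and \<open>Y'\<close> are representatives, so two of them with a rational
    difference are equal; this separates the spectra as required.\<close>
  have rep: "r (jordan_matrix (R bs) $$ (i, i)) = jordan_matrix (R bs) $$ (i, i)"
    if "i < sum_list (map fst bs)" for bs i
    using jordan_matrix_diag_mem[of i "R bs"] that
    by (auto simp: fR) (auto simp: R_def r_def rational_class_rep_idem)
  have "similar_mat (of_nat m \<cdot>\<^sub>m Y') (of_nat m \<cdot>\<^sub>m X')"
  proof (rule gl_equivalent_constant_imp_similar[OF _ _ _ _ _ gl])
    fix i j assume ij: "i < n" "j < n"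
      and z: "(of_nat m \<cdot>\<^sub>m Y') $$ (i, i) - (of_nat m \<cdot>\<^sub>m X') $$ (j, j) \<in> \<int>"
    then have "of_nat m * (Y' $$ (i, i) - X' $$ (j, j)) \<in> \<rat>"
      using X' Y' Ints_subset_Rats by (auto simp: algebra_simps)
    then have "of_nat m * (Y' $$ (i, i) - X' $$ (j, j)) / of_nat m \<in> \<rat>" by (intro Rats_divide) auto
    then have "Y' $$ (i, i) - X' $$ (j, j) \<in> \<rat>" using m by simp
    then have "r (Y' $$ (i, i)) = r (X' $$ (j, j))" by (simp add: r_def rational_class_rep_eq_iff)
    then have "Y' $$ (i, i) = X' $$ (j, j)"
      using rep[of i ys] rep[of j xs] ij xs' ys' by (simp add: X'_def Y'_def)
    then show "(of_nat m \<cdot>\<^sub>m Y') $$ (i, i) = (of_nat m \<cdot>\<^sub>m X') $$ (j, j)"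
      using ij X' Y' by simp
  qed (use X' Y' ut in \<open>auto simp: X'_def Y'_def\<close>)
  moreover have "of_nat m \<noteq> (0 :: 'k)" using m by simp
  ultimately have sim: "similar_mat Y' X'" using similar_mat_smult_cancel[OF Y' X'] by blast
  have R0: "0 \<notin> fst ` set (R bs)" if "0 \<notin> fst ` set bs" for bs using that by (force simp: R_def)
  have "jordan_nf Y' (R xs)" using sim R0[OF xs'(3)] by (simp add: jordan_nf_def X'_def)
  moreover have "jordan_nf Y' (R ys)"
    using similar_mat_refl[OF Y'] R0[OF ys'(3)] by (simp add: jordan_nf_def Y'_def)
  ultimately have ms: "mset (R xs) = mset (R ys)" by (rule jordan_nf_unique_mset)
  then have len: "length xs = length ys" using mset_eq_length by (fastforce simp: R_def)
  obtain t where t: "t permutes {..<length (R ys)}" "permute_list t (R ys) = R xs"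
    using mset_eq_permutation[OF ms] by blast
  have lR: "length (R bs) = length bs" for bs by (simp add: R_def)
  have "fst (xs ! i) = fst (ys ! t i) \<and> snd (xs ! i) - snd (ys ! t i) \<in> \<rat>" if i: "i < length xs" for i
  proof -
    have ti: "t i < length ys" using permutes_in_image[OF t(1), of i] i len by (simp add: lR)
    have "R xs ! i = R ys ! t i" using permute_list_nth[OF t(1), of i] t(2) i len by (simp add: lR)
    then show ?thesis using i ti len by (simp add: R_def r_def rational_class_rep_eq_iff)
  qed
  then show ?thesis unfolding differ_rationally_after_block_permutation_def
    using xs ys len t(1) by (intro exI[of _ xs] exI[of _ ys] exI[of _ t] conjI) (auto simp: lR)
qed

lemma dlog_regular:
  assumes "X \<in> sl n"
  shows "dlog X \<in> regular_connections n"
proof -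
  have X: "X \<in> carrier_mat n n" using assms by (simp add: sl_def)
  have "dlog X \<in> sl_power_series n"
    using dlog_sl[OF assms] X
    by (auto simp: sl_power_series_def simp flip: fps_const_to_fls)
  then show ?thesis
    using dlog_sl[OF assms] gauge_equivalent_refl[of "dlog X" n] X by (auto simp: regular_connections_def)
qed

theorem theorem6p9:
  fixes n :: nat
  assumes "n \<ge> 1"
  shows
    "(\<lambda>X. relationship_on n (regular_connections n) `` {dlog X}) `
        (jordan_sl n :: 'k :: {alg_closed_field, field_char_0} mat set) =
       regular_connections n // relationship_on n (regular_connections n)
     \<and>
     (\<forall>X \<in> jordan_sl n. \<forall>Y \<in> jordan_sl n.
       related n (dlog X) (dlog (Y :: 'k mat)) \<longleftrightarrow>
         differ_rationally_after_block_permutation X Y)"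
proof (intro conjI ballI iffI equalityI subsetI)
  define S where "S = (regular_connections n :: 'k fls mat set)"
  define E where "E = relationship_on n S"
  have E: "equiv S E" unfolding E_def S_def
    by (rule equiv_relationship_on) (auto simp: regular_connections_def)
  have reg: "dlog X \<in> S" if "X \<in> jordan_sl n" for X
    using that dlog_regular by (auto simp: S_def jordan_sl_def)
  fix C
  {
    assume "C \<in> (\<lambda>X. relationship_on n (regular_connections n) `` {dlog X}) ` (jordan_sl n :: 'k mat set)"
    then show "C \<in> regular_connections n // relationship_on n (regular_connections n)"
      using reg by (auto simp: S_def quotient_def)
  }
  assume "C \<in> regular_connections n // relationship_on n (regular_connections n :: 'k fls mat set)"
  then obtain A where A: "A \<in> S" "C = E `` {A}" by (auto simp: quotient_def S_def E_def)
  obtain X where X: "X \<in> jordan_sl n" "related n A (dlog X)"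
    using regular_related_to_jordan[OF assms] A by (auto simp: S_def)
  then have "(A, dlog X) \<in> E" using A reg by (auto simp: E_def relationship_on_def)
  then have "C = E `` {dlog X}" using equiv_class_eq[OF E] A by simp
  then show "C \<in> (\<lambda>X. relationship_on n (regular_connections n) `` {dlog X}) ` (jordan_sl n :: 'k mat set)"
    using X by (auto simp: E_def S_def)
qed (use differ_rationally_imp_related[OF assms] related_imp_differ_rationally in blast)+

end
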